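(* Let $\ell\in2\mathbb N_0$ and let $H:(0,1]\to\mathbb C^{\ell+1}$ be a simultaneous eigenfunction of $D$ and $E$ in $(0,1)$, continuous in $(0,1]$, with respective eigenvalues $\lambda=-n(n+2)$, $n\in\mathbb C$, and $\mu\in\mathbb C$. Then $H$ is of the form $$H(u)=U\,T(u)\,P(u),$$ where $P=(p_0,\dots,p_\ell)^t$ is given by $$p_j(u)=a_j\;{}_2F_1\!\left(-n+j,n+j+2;j+\tfrac32;\tfrac{1-u}2\right),\qquad0\le j\le\ell,$$ and $\{a_j\}_{j=0}^\ell$ satisfies $$i\,\tfrac{j(\ell-j+1)(n-j+1)(n+j+1)}{2(2j-1)(2j+1)}\,a_{j-1}-\tfrac{j(j+1)}2\,a_j-i\,\tfrac{(j+1)(\ell+j+2)}2\,a_{j+1}=\mu\,a_j,\qquad0\le j\le\ell-1$$ (with $a_{-1}=0$), and $$i\,\tfrac{\ell(n-\ell+1)(n+\ell+1)}{2(2\ell-1)(2\ell+1)}\,a_{\ell-1}-\tfrac{\ell(\ell+1)}2\,a_\ell=\mu\,a_\ell.$$ Moreover $H(1)=a_0(1,1,\dots,1)^t$. In particular, if $H(u)$ is associated to an irreducible spherical function of $(\mathrm{SO}(4),\mathrm{SO}(3))$ of type $\pi_\ell$, then $a_0=1$.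
   Context: Matrices have size $\ell+1$ with indices $0,\dots,\ell$; $E_{jk}$ are matrix units. On $\mathbb C^{\ell+1}$-valued functions of $u\in(0,1)$: $$DH=(1-u^2)H''-3uH'+\tfrac1{1-u^2}(C_0+C_1)H,$$ $$EH=\tfrac i2\sqrt{1-u^2}\,A_0H'+\tfrac i2\tfrac u{\sqrt{1-u^2}}(C_1-C_0)H+\tfrac12(C_0+C_1)H,$$ with $A_0=\sum_{j=0}^\ell(\ell-2j)E_{jj}$, $C_0=\sum_{j=1}^\ell j(\ell-j+1)(E_{j,j-1}-E_{jj})$, $C_1=\sum_{j=0}^{\ell-1}(j+1)(\ell-j)(E_{j,j+1}-E_{jj})$. $U=(U_{jk})$, $U_{jk}={}_3F_2(-k,-j,k+1;1,-\ell;1)$; $T(u)=\sum_{j=0}^\ell(1-u^2)^{j/2}E_{jj}$. Associated function $H(u)$: let $G=\mathrm{SO}(4)$, $K=\mathrm{SO}(3)$ embedded as $k\mapsto\mathrm{diag}(k,1)$, and $\pi=\pi_\ell$ the $(\ell+1)$-dimensional irreducible representation of $K$ on $V_\pi$. An irreducible spherical function of type $\pi$ is a continuous $\Phi:G\to\mathrm{End}(V_\pi)$ with $\Phi(e)=I$, $\Phi|_K=\pi$ and $\Phi(x)\Phi(y)=\int_K\chi(k^{-1})\Phi(xky)\,dk$, $\chi$ being $(\ell+1)$ times the character of $\pi$. Let $a:\mathrm{SO}(4)\to\mathrm{SO}(3)$ send $g$ to the matrix of its action on the invariant subspace of $\Lambda^2(\mathbb R^4)$ with basis $e_1\wedge e_4+e_2\wedge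 e_3,\ e_2\wedge e_4-e_1\wedge e_3,\ e_3\wedge e_4+e_1\wedge e_2$. Put $H(g)=\Phi(g)\pi(a(g))^{-1}$. Let $\{v_j\}_{j=0}^\ell$ be the basis of $V_\pi$ with $\dot\pi(h)v_j=(\ell-2j)v_j$, $\dot\pi(e)v_j=(\ell-j+1)v_{j-1}$, $\dot\pi(f)v_j=(j+1)v_{j+1}$, where $e=\begin{pmatrix}0&i&-1\\-i&0&0\\1&0&0\end{pmatrix}$, $f=\begin{pmatrix}0&i&1\\-i&0&0\\-1&0&0\end{pmatrix}$, $h=\begin{pmatrix}0&0&0\\0&0&-2i\\0&2i&0\end{pmatrix}$. For $g=a(\theta)=\exp\theta(E_{14}-E_{41})\in\mathrm{SO}(4)$ (here $E_{14},E_{41}$ are $4\times 4$ matrix units), $0\le\theta<\pi/2$, $u=\cos\theta$, one has $H(a(\theta))v_j=h_j(u)v_j$, and the associated function is $H(u)=(h_0(u),\dots,h_\ell(u))^t$. *)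

theory Defs
  imports "HOL-Analysis.Analysis" "HOL-Computational_Algebra.Formal_Power_Series"
begin

section \<open>The operators \<open>D\<close> and \<open>E\<close>\<close>

text \<open>
  Vectors of \<open>\<complex>\<^sup>l\<^sup>+\<^sup>1\<close> and square matrices of size \<open>l + 1\<close> are functions of indices in \<open>{0..l}\<close>;
  values at indices above \<open>l\<close> are irrelevant.
\<close>

type_synonym cvec = "nat \<Rightarrow> complex"
type_synonym cmat = "nat \<Rightarrow> nat \<Rightarrow> complex"

definition mat_vec :: "nat \<Rightarrow> cmat \<Rightarrow> cvec \<Rightarrow> cvec" where
  "mat_vec l M x = (\<lambda>j. \<Sum>k\<le>l. M j k * x k)"

definition matrix_unit :: "nat \<Rightarrow> nat \<Rightarrow> cmat" where
  "matrix_unit j k = (\<lambda>r s. if r = j \<and> s = k then 1 else 0)"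

definition A0 :: "nat \<Rightarrow> cmat" where
  "A0 l = (\<lambda>r s. \<Sum>j=0..l. (of_nat l - 2 * of_nat j) * matrix_unit j j r s)"

definition C0 :: "nat \<Rightarrow> cmat" where
  "C0 l = (\<lambda>r s. \<Sum>j=1..l. of_nat j * (of_nat l - of_nat j + 1) *
     (matrix_unit j (j - 1) r s - matrix_unit j j r s))"

definition C1 :: "nat \<Rightarrow> cmat" where
  "C1 l = (\<lambda>r s. \<Sum>j=0..<l. (of_nat j + 1) * (of_nat l - of_nat j) *
     (matrix_unit j (j + 1) r s - matrix_unit j j r s))"

definition vec_deriv :: "(real \<Rightarrow> cvec) \<Rightarrow> real \<Rightarrow> cvec" where
  "vec_deriv H = (\<lambda>u j. vector_derivative (\<lambda>t. H t j) (at u))"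

definition twice_differentiable_on :: "nat \<Rightarrow> (real \<Rightarrow> cvec) \<Rightarrow> real set \<Rightarrow> bool" where
  "twice_differentiable_on l H S \<longleftrightarrow>
     (\<forall>u\<in>S. \<forall>j\<le>l. (\<lambda>t. H t j) differentiable (at u) \<and>
                  (\<lambda>t. vec_deriv H t j) differentiable (at u))"

definition op_D :: "nat \<Rightarrow> (real \<Rightarrow> cvec) \<Rightarrow> real \<Rightarrow> cvec" where
  "op_D l H = (\<lambda>u j.
     of_real (1 - u^2) * vec_deriv (vec_deriv H) u j
     - 3 * of_real u * vec_deriv H u j
     + of_real (1 / (1 - u^2)) * mat_vec l (\<lambda>r s. C0 l r s + C1 l r s) (H u) j)"

definition op_E :: "nat \<Rightarrow> (real \<Rightarrow> cvec) \<Rightarrow> real \<Rightarrow> cvec" where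
  "op_E l H = (\<lambda>u j.
     \<i> / 2 * of_real (sqrt (1 - u^2)) * mat_vec l (A0 l) (vec_deriv H u) j
     + \<i> / 2 * of_real (u / sqrt (1 - u^2)) * mat_vec l (\<lambda>r s. C1 l r s - C0 l r s) (H u) j
     + 1 / 2 * mat_vec l (\<lambda>r s. C0 l r s + C1 l r s) (H u) j)"

text \<open>
  \<open>L H = \<lambda> H\<close> on \<open>S\<close>, for \<open>H\<close> smooth enough for \<open>L H\<close> to make sense.
  The zero function is not excluded.
\<close>

definition eigenfunction_on ::
  "nat \<Rightarrow> ((real \<Rightarrow> cvec) \<Rightarrow> real \<Rightarrow> cvec) \<Rightarrow> complex \<Rightarrow> (real \<Rightarrow> cvec) \<Rightarrow> real set \<Rightarrow> bool" where
  "eigenfunction_on l L ev H S \<longleftrightarrow>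
     twice_differentiable_on l H S \<and> (\<forall>u\<in>S. \<forall>j\<le>l. L H u j = ev * H u j)"


section \<open>Hypergeometric functions and the matrices \<open>U\<close> and \<open>T(u)\<close>\<close>

definition hypergeometric :: "complex list \<Rightarrow> complex list \<Rightarrow> complex \<Rightarrow> complex" where
  "hypergeometric as bs z = eval_fps (fps_hypergeo as bs 1) z"

text \<open>
  For \<open>j, k \<le> l\<close> the series below terminates at index \<open>min j k\<close>: the terms with vanishing
  numerator are zero, including those of index above \<open>l\<close>, where \<open>0 / 0 = 0\<close>.
\<close>

definition U_mat :: "nat \<Rightarrow> cmat" where
  "U_mat l = (\<lambda>j k.
     hypergeometric [- of_nat k, - of_nat j, of_nat k + 1] [1, - of_nat l] 1)"

text \<open>
  \<open>(1 - u\<^sup>2)\<close> to the power \<open>j / 2\<close> is written \<open>sqrt (1 - u\<^sup>2) ^ j\<close> because \<open>0 powr 0 = 0\<close> would give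
  the wrong entry for \<open>j = 0\<close> at \<open>u = 1\<close>.
\<close>

definition T_mat :: "nat \<Rightarrow> real \<Rightarrow> cmat" where
  "T_mat l u = (\<lambda>r s. \<Sum>j=0..l. of_real (sqrt (1 - u^2) ^ j) * matrix_unit j j r s)"


section \<open>Representations of \<open>SO(3)\<close>\<close>

definition SO3 :: "(real^3^3) set" where
  "SO3 = {k. rotation_matrix k}"

definition SO4 :: "(real^4^4) set" where
  "SO4 = {g. rotation_matrix g}"

definition embed_SO3 :: "real^3^3 \<Rightarrow> real^4^4" where
  "embed_SO3 k = vector
     [vector [k$1$1, k$1$2, k$1$3, 0],
      vector [k$2$1, k$2$2, k$2$3, 0],
      vector [k$3$1, k$3$2, k$3$3, 0],
      vector [0, 0, 0, 1]]"

definition mat_exp :: "real^'m^'m \<Rightarrow> real^'m^'m" where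
  "mat_exp A = (\<Sum>k. (1 / fact k) *\<^sub>R (((**) A ^^ k) (mat 1)))"

text \<open>The space of the representation is \<open>\<complex>\<^sup>l\<^sup>+\<^sup>1\<close> with an index type of cardinality \<open>l + 1\<close>.\<close>

definition irreducible_rep_SO3 :: "nat \<Rightarrow> (real^3^3 \<Rightarrow> complex^'n^'n) \<Rightarrow> bool" where
  "irreducible_rep_SO3 l \<pi> \<longleftrightarrow>
     CARD('n) = l + 1 \<and>
     continuous_on SO3 \<pi> \<and>
     \<pi> (mat 1) = mat 1 \<and>
     (\<forall>x\<in>SO3. \<forall>y\<in>SO3. \<pi> (x ** y) = \<pi> x ** \<pi> y) \<and>
     (\<forall>W. vec.subspace W \<and> (\<forall>k\<in>SO3. \<forall>w\<in>W. \<pi> k *v w \<in> W) \<longrightarrow> W = {0} \<or> W = UNIV)"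

definition lie_derivative :: "(real^3^3 \<Rightarrow> complex^'n^'n) \<Rightarrow> real^3^3 \<Rightarrow> complex^'n^'n" where
  "lie_derivative \<pi> X = vector_derivative (\<lambda>t. \<pi> (mat_exp (t *\<^sub>R X))) (at 0)"

text \<open>
  The complex-linear extension of the differential of \<open>\<pi>\<close> to the complexification of \<open>so(3)\<close>:
  real and imaginary parts of \<open>Z\<close> are skew-symmetric. The product with \<open>mat \<i>\<close> is the
  multiplication by the scalar \<open>\<i>\<close>.
\<close>

definition complexified_derivative ::
  "(real^3^3 \<Rightarrow> complex^'n^'n) \<Rightarrow> complex^3^3 \<Rightarrow> complex^'n^'n" where
  "complexified_derivative \<pi> Z =
     lie_derivative \<pi> (\<chi> r s. Re (Z$r$s)) + mat \<i> ** lie_derivative \<pi> (\<chi> r s. Im (Z$r$s))"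

definition lie_e :: "complex^3^3" where
  "lie_e = vector [vector [0, \<i>, -1], vector [-\<i>, 0, 0], vector [1, 0, 0]]"

definition lie_f :: "complex^3^3" where
  "lie_f = vector [vector [0, \<i>, 1], vector [-\<i>, 0, 0], vector [-1, 0, 0]]"

definition lie_h :: "complex^3^3" where
  "lie_h = vector [vector [0, 0, 0], vector [0, 0, -2 * \<i>], vector [0, 2 * \<i>, 0]]"

text \<open>The conventions are \<open>v\<^sub>j = 0\<close> for \<open>j = -1\<close> and for \<open>j = l + 1\<close>.\<close>

definition weight_basis ::
  "nat \<Rightarrow> (real^3^3 \<Rightarrow> complex^'n^'n) \<Rightarrow> (nat \<Rightarrow> complex^'n) \<Rightarrow> bool" where
  "weight_basis l \<pi> v \<longleftrightarrow>
     inj_on v {0..l} \<and> vec.independent (v ` {0..l}) \<and> vec.span (v ` {0..l}) = UNIV \<and>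
     (\<forall>j\<le>l.
        complexified_derivative \<pi> lie_h *v v j = (of_nat l - 2 * of_nat j) *s v j \<and>
        complexified_derivative \<pi> lie_e *v v j =
          (of_nat l - of_nat j + 1) *s (if j = 0 then 0 else v (j - 1)) \<and>
        complexified_derivative \<pi> lie_f *v v j =
          (of_nat j + 1) *s (if j = l then 0 else v (j + 1)))"


section \<open>Irreducible spherical functions of \<open>(SO(4), SO(3))\<close>\<close>

definition normalized_haar_SO3 :: "(real^3^3) measure \<Rightarrow> bool" where
  "normalized_haar_SO3 dk \<longleftrightarrow>
     sets dk = sets (restrict_space borel SO3) \<and>
     emeasure dk SO3 = 1 \<and>
     (\<forall>k\<in>SO3. distr dk dk (\<lambda>x. k ** x) = dk)"

definition chi :: "nat \<Rightarrow> (real^3^3 \<Rightarrow> complex^'n^'n) \<Rightarrow> real^3^3 \<Rightarrow> complex" where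
  "chi l \<pi> k = (of_nat l + 1) * trace (\<pi> k)"

text \<open>
  The normalized Haar measure is unique, so the existential quantifier over \<open>dk\<close> just names it.
  The product with \<open>mat c\<close> is the multiplication by the scalar \<open>c\<close>.
\<close>

definition irreducible_spherical_function ::
  "nat \<Rightarrow> (real^3^3 \<Rightarrow> complex^'n^'n) \<Rightarrow> (real^4^4 \<Rightarrow> complex^'n^'n) \<Rightarrow> bool" where
  "irreducible_spherical_function l \<pi> \<Phi> \<longleftrightarrow>
     continuous_on SO4 \<Phi> \<and>
     \<Phi> (mat 1) = mat 1 \<and>
     (\<forall>k\<in>SO3. \<Phi> (embed_SO3 k) = \<pi> k) \<and>
     (\<exists>dk. normalized_haar_SO3 dk \<and>
        (\<forall>x\<in>SO4. \<forall>y\<in>SO4.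
           \<Phi> x ** \<Phi> y =
             (\<integral>k. mat (chi l \<pi> (matrix_inv k)) ** \<Phi> (x ** embed_SO3 k ** y) \<partial>dk)))"

text \<open>
  The exterior square of \<open>\<real>\<^sup>4\<close> is realized as the space of skew-symmetric matrices, with
  \<open>x \<and> y\<close> corresponding to \<open>x y\<^sup>t - y x\<^sup>t\<close>; then \<open>g x \<and> g y\<close> corresponds to \<open>g (x \<and> y) g\<^sup>t\<close>.
\<close>

definition wedge :: "real^4 \<Rightarrow> real^4 \<Rightarrow> real^4^4" where
  "wedge x y = (\<chi> r s. x$r * y$s - y$r * x$s)"

definition e4 :: "4 \<Rightarrow> real^4" where
  "e4 r = axis r 1"

definition Lambda_basis :: "(real^4^4)^3" where
  "Lambda_basis = vector
     [wedge (e4 1) (e4 4) + wedge (e4 2) (e4 3),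
      wedge (e4 2) (e4 4) - wedge (e4 1) (e4 3),
      wedge (e4 3) (e4 4) + wedge (e4 1) (e4 2)]"

definition a_map :: "real^4^4 \<Rightarrow> real^3^3" where
  "a_map g = (THE A. \<forall>q.
     g ** (Lambda_basis$q) ** transpose g = (\<Sum>p\<in>UNIV. (A$p$q) *\<^sub>R (Lambda_basis$p)))"

text \<open>The term \<open>axis r (axis s 1)\<close> is the matrix unit with its nonzero entry in row \<open>r\<close>, column \<open>s\<close>.\<close>

definition a_curve :: "real \<Rightarrow> real^4^4" where
  "a_curve \<theta> = mat_exp (\<theta> *\<^sub>R (axis 1 (axis 4 1) - axis 4 (axis 1 1)))"

definition H_group ::
  "(real^3^3 \<Rightarrow> complex^'n^'n) \<Rightarrow> (real^4^4 \<Rightarrow> complex^'n^'n) \<Rightarrow> real^4^4 \<Rightarrow> complex^'n^'n" where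
  "H_group \<pi> \<Phi> g = \<Phi> g ** matrix_inv (\<pi> (a_map g))"

definition associated_function ::
  "nat \<Rightarrow> (real^3^3 \<Rightarrow> complex^'n^'n) \<Rightarrow> (real^4^4 \<Rightarrow> complex^'n^'n) \<Rightarrow> (real \<Rightarrow> cvec) \<Rightarrow> bool" where
  "associated_function l \<pi> \<Phi> H \<longleftrightarrow>
     (\<exists>v. weight_basis l \<pi> v \<and>
        (\<forall>\<theta>\<in>{0..<pi/2}. \<forall>j\<le>l.
           H_group \<pi> \<Phi> (a_curve \<theta>) *v v j = H (cos \<theta>) j *s v j))"

end

theory Submission
  imports Defs
begin

text \<open>
  Everything rests on the fact that the columns of \<open>U\<close> are Hahn polynomials (the discrete Chebyshev
  polynomials on the points \<open>0, \<dots>, l\<close>). Their difference equation says that the \<open>k\<close>-th column is an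
  eigenvector of \<open>C\<^sub>0 + C\<^sub>1\<close> with eigenvalue \<open>-k(k + 1)\<close> (\<open>C_sum_column\<close>), and their three-term
  recurrence says that the diagonal matrix \<open>A\<^sub>0\<close> maps the \<open>k\<close>-th column to a combination of its two
  neighbours (\<open>A0_column\<close>). The remaining matrix of \<open>E\<close> costs nothing more, since
  \<open>C\<^sub>1 - C\<^sub>0 = - 1/2 [C\<^sub>0 + C\<^sub>1, A\<^sub>0] - A\<^sub>0\<close>. As \<open>C\<^sub>0 + C\<^sub>1\<close> is symmetric, the columns are orthogonal, which
  gives an explicit inverse of \<open>U\<close>.

  Writing \<open>H = U h\<close>, the equation for \<open>D\<close> therefore decouples into one scalar equation for each \<open>h\<^sub>k\<close>,
  and \<open>(1 - u\<^sup>2)\<^bsup>k/2\<^esup>\<close> times the hypergeometric function of the theorem is a solution of it. A second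
  solution behaves like \<open>(1 - u)\<^bsup>-(k + 1)/2\<^esup>\<close> at \<open>1\<close>, so continuity at \<open>1\<close> leaves only the multiples
  \<open>a\<^sub>k\<close> of the first one; the Wronskian makes this precise (\<open>solution_unique\<close>).

  In the basis of the columns, the equation for \<open>E\<close> only links neighbouring indices. Its \<open>k\<close>-th
  component is divisible by \<open>(1 - u\<^sup>2)\<^bsup>k/2\<^esup>\<close>, and what remains of it at \<open>u = 1\<close> is the recursion for
  \<open>a\<close>: only the values of the hypergeometric functions and of their first derivatives at \<open>0\<close> enter
  (\<open>recursion_from_ladder\<close>). At \<open>u = 1\<close> the matrix \<open>T\<close> retains only its entry \<open>(0, 0)\<close>, and column \<open>0\<close>
  of \<open>U\<close> is constant \<open>1\<close>, whence \<open>H(1) = a\<^sub>0(1, \<dots>, 1)\<close>. For an associated function, \<open>u = 1\<close> is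
  \<open>\<theta> = 0\<close>, where \<open>\<Phi>\<close> and \<open>\<pi>\<close> are the identity.
\<close>

section \<open>Hahn polynomials\<close>

text \<open>
  The parameter \<open>\<kappa>\<close> is complex because \<open>\<kappa> - 1\<close> and \<open>\<kappa> + 1\<close> occur in the recurrence, also when the
  column index \<open>\<kappa>\<close> is \<open>0\<close>. The sum in \<open>hahn\<close> may stop at \<open>l\<close>: the entries of \<open>U\<close> are its values at the
  integers \<open>x \<le> l\<close>, where \<open>pochhammer (- x) i\<close> vanishes for \<open>i > l\<close>.
\<close>

definition hahn_coeff :: "nat \<Rightarrow> complex \<Rightarrow> nat \<Rightarrow> complex" where
  "hahn_coeff l \<kappa> i =
     pochhammer (- \<kappa>) i * pochhammer (\<kappa> + 1) i / (fact i ^ 2 * pochhammer (- of_nat l) i)"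

definition hahn :: "nat \<Rightarrow> complex \<Rightarrow> complex \<Rightarrow> complex" where
  "hahn l \<kappa> x = (\<Sum>i\<le>l. hahn_coeff l \<kappa> i * pochhammer (- x) i)"

lemma pochhammer_neg_of_nat_nonzero:
  "i \<le> l \<Longrightarrow> pochhammer (- of_nat l :: complex) i \<noteq> 0"
  by (simp add: pochhammer_of_nat_eq_0_iff)

lemma hahn_coeff_Suc:
  assumes "i < l"
  shows "of_nat (Suc i) ^ 2 * (of_nat i - of_nat l) * hahn_coeff l \<kappa> (Suc i)
    = (of_nat i - \<kappa>) * (of_nat i + \<kappa> + 1) * hahn_coeff l \<kappa> i"
proof -
  have nz: "pochhammer (- of_nat l :: complex) i \<noteq> 0" "(of_nat i - of_nat l :: complex) \<noteq> 0"
    "(of_nat (Suc i) :: complex) \<noteq> 0"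
    using assms pochhammer_neg_of_nat_nonzero[of i l] by (auto simp del: of_nat_Suc)
  have P: "pochhammer (- of_nat l :: complex) (Suc i) = pochhammer (- of_nat l) i * (of_nat i - of_nat l)"
    "fact (Suc i) = (of_nat (Suc i) * fact i :: complex)"
    by (simp_all add: pochhammer_Suc)
  have Q: "pochhammer (- \<kappa>) (Suc i) = pochhammer (- \<kappa>) i * (of_nat i - \<kappa>)"
     "pochhammer (\<kappa> + 1) (Suc i) = pochhammer (\<kappa> + 1) i * (of_nat i + \<kappa> + 1)"
    by (simp_all add: pochhammer_Suc algebra_simps)
  show ?thesis
    unfolding hahn_coeff_def P Q power_mult_distrib
    using nz by (simp add: field_simps del: of_nat_Suc)
qed

lemma pochhammer_neg_minus_one:
  fixes x :: complex
  shows "x * pochhammer (- (x - 1)) i = (x - of_nat i) * pochhammer (- x) i"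
proof -
  have "- x * pochhammer (- x + 1) i = pochhammer (- x) i * (- x + of_nat i)"
    using pochhammer_rec[of "- x" i] pochhammer_Suc[of "- x" i] by simp
  then show ?thesis by (simp add: algebra_simps)
qed

lemma pochhammer_neg_plus_one:
  fixes x :: complex
  shows "pochhammer (- (x + 1)) (Suc i) = - (x + 1) * pochhammer (- x) i"
  using pochhammer_rec[of "- (x + 1)" i] by simp

text \<open>
  This is \<open>C\<^sub>0 + C\<^sub>1\<close> as a difference operator on functions of a complex variable. The factors \<open>x\<close> and
  \<open>l - x\<close> cancel the values at \<open>-1\<close> and \<open>l + 1\<close>.
\<close>

definition hahn_op :: "nat \<Rightarrow> (complex \<Rightarrow> complex) \<Rightarrow> complex \<Rightarrow> complex" where
  "hahn_op l f x = x * (of_nat l - x + 1) * (f (x - 1) - f x)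
     + (x + 1) * (of_nat l - x) * (f (x + 1) - f x)"

text \<open>
  The operator is bidiagonal in the basis of the functions \<open>pochhammer (- x) i\<close>, so that the
  coefficients of its eigenfunctions satisfy a two-term recursion.
\<close>

lemma hahn_op_pochhammer_Suc:
  "hahn_op l (\<lambda>x. pochhammer (- x) (Suc i)) x
   = - (of_nat (Suc i) * of_nat (Suc (Suc i)) * pochhammer (- x) (Suc i))
     - of_nat (Suc i) ^ 2 * (of_nat l - of_nat i) * pochhammer (- x) i"
proof -
  define P where "P = pochhammer (- x) i"
  have 1: "pochhammer (- x) (Suc i) = P * (of_nat i - x)"
    by (simp add: P_def pochhammer_Suc)
  have 2: "x * pochhammer (- (x - 1)) (Suc i) = (x - of_nat i - 1) * (P * (of_nat i - x))"
    using pochhammer_neg_minus_one[of x "Suc i"] 1 by (simp add: algebra_simps)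
  have 3: "pochhammer (- (x + 1)) (Suc i) = - (x + 1) * P"
    unfolding P_def by (rule pochhammer_neg_plus_one)
  have "hahn_op l (\<lambda>x. pochhammer (- x) (Suc i)) x =
     (of_nat l - x + 1) * (x * pochhammer (- (x - 1)) (Suc i) - x * pochhammer (- x) (Suc i))
     + (x + 1) * (of_nat l - x) * (pochhammer (- (x + 1)) (Suc i) - pochhammer (- x) (Suc i))"
    by (simp add: hahn_op_def algebra_simps)
  also have "\<dots> = - (of_nat (Suc i) * of_nat (Suc (Suc i)) * (P * (of_nat i - x)))
     - of_nat (Suc i) ^ 2 * (of_nat l - of_nat i) * P"
    unfolding 2 unfolding 3 1 by (simp add: power2_eq_square) algebra
  finally show ?thesis unfolding 1 P_def .
qed

lemma hahn_op_sum:
  "hahn_op l (\<lambda>x. \<Sum>i\<in>A. c i * f i x) x = (\<Sum>i\<in>A. c i * hahn_op l (f i) x)"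
  by (simp add: hahn_op_def sum_distrib_left sum_subtractf sum.distrib algebra_simps)

text \<open>
  By \<open>hahn_coeff_Suc\<close> the sum of the residual terms telescopes: its partial sums are single terms,
  and the last one vanishes because either \<open>k = l\<close> or the series stops before \<open>l\<close>.
\<close>

lemma hahn_difference_equation:
  assumes "k \<le> l"
  shows "hahn_op l (hahn l (of_nat k)) x = - (of_nat k * (of_nat k + 1)) * hahn l (of_nat k) x"
proof -
  define c where "c = hahn_coeff l (of_nat k)"
  define b where "b = (\<lambda>i x :: complex. pochhammer (- x) i)"
  have partial: "N \<le> l \<Longrightarrow> (\<Sum>i\<le>N. c i * (hahn_op l (b i) x + of_nat k * (of_nat k + 1) * b i x))
     = - (of_nat N - of_nat k) * (of_nat N + of_nat k + 1) * c N * b N x" for N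
  proof (induction N)
    case 0
    show ?case by (simp add: b_def hahn_op_def algebra_simps)
  next
    case (Suc N)
    then have IH: "(\<Sum>i\<le>N. c i * (hahn_op l (b i) x + of_nat k * (of_nat k + 1) * b i x))
     = - (of_nat N - of_nat k) * (of_nat N + of_nat k + 1) * c N * b N x" by simp
    have rec: "of_nat (Suc N) ^ 2 * (of_nat N - of_nat l) * c (Suc N)
        = (of_nat N - of_nat k) * (of_nat N + of_nat k + 1) * c N"
      unfolding c_def using hahn_coeff_Suc Suc.prems by simp
    have op: "hahn_op l (b (Suc N)) x = - (of_nat (Suc N) * of_nat (Suc (Suc N)) * b (Suc N) x)
     - of_nat (Suc N) ^ 2 * (of_nat l - of_nat N) * b N x"
      unfolding b_def by (rule hahn_op_pochhammer_Suc)
    have "- (of_nat N - of_nat k) * (of_nat N + of_nat k + 1) * c N * b N x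
        = - (of_nat (Suc N) ^ 2 * (of_nat N - of_nat l) * c (Suc N)) * b N x"
      unfolding rec by (simp only: mult_minus_left)
    then show ?case
      unfolding sum.atMost_Suc IH op
      by (simp add: algebra_simps power2_eq_square)
  qed
  have "(of_nat l - of_nat k) * c l = 0"
  proof (cases "k = l")
    case False
    then have "pochhammer (- of_nat k :: complex) l = 0"
      using assms by (simp add: pochhammer_of_nat_eq_0_iff)
    then show ?thesis by (simp add: c_def hahn_coeff_def)
  qed simp
  then have "(\<Sum>i\<le>l. c i * (hahn_op l (b i) x + of_nat k * (of_nat k + 1) * b i x)) = 0"
    using partial[of l] by auto
  then have "(\<Sum>i\<le>l. c i * hahn_op l (b i) x) + of_nat k * (of_nat k + 1) * (\<Sum>i\<le>l. c i * b i x) = 0"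
    by (simp add: sum.distrib sum_distrib_left algebra_simps)
  moreover have "hahn_op l (hahn l (of_nat k)) x = (\<Sum>i\<le>l. c i * hahn_op l (b i) x)"
    unfolding hahn_op_sum[symmetric] by (simp add: hahn_def[abs_def] c_def b_def)
  moreover have "hahn l (of_nat k) x = (\<Sum>i\<le>l. c i * b i x)"
    by (simp add: hahn_def c_def b_def)
  ultimately show ?thesis
    by (simp only: add_eq_0_iff2 mult_minus_left)
qed

text \<open>
  The recurrence for the coefficient of \<open>pochhammer (- x) (Suc m)\<close>. All numerators are multiples of
  \<open>pochhammer (- \<kappa>) m * pochhammer (\<kappa> + 1) m\<close>, which reduces it to a polynomial identity.
\<close>

lemma hahn_coeff_contiguous:
  assumes "m < l" and nz: "2 * \<kappa> + 1 \<noteq> 0"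
  shows "(of_nat l - 2 * of_nat (Suc m)) * hahn_coeff l \<kappa> (Suc m)
     - (\<kappa> + 1) * (of_nat l - \<kappa>) / (2 * \<kappa> + 1) * hahn_coeff l (\<kappa> + 1) (Suc m)
     - \<kappa> * (\<kappa> + of_nat l + 1) / (2 * \<kappa> + 1) * hahn_coeff l (\<kappa> - 1) (Suc m)
     = - 2 * hahn_coeff l \<kappa> m"
proof -
  define g where "g = pochhammer (- \<kappa>) m * pochhammer (\<kappa> + 1) m"
  define K where "K = (fact m ^ 2 * pochhammer (- of_nat l) m :: complex)"
  have Knz: "K \<noteq> 0" and dnz: "(of_nat m - of_nat l :: complex) \<noteq> 0"
    "(of_nat (Suc m) :: complex) \<noteq> 0"
    using assms pochhammer_neg_of_nat_nonzero[of m l] by (auto simp: K_def simp del: of_nat_Suc)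
  have K: "fact (Suc m) ^ 2 * pochhammer (- of_nat l) (Suc m)
      = K * (of_nat (Suc m) ^ 2 * (of_nat m - of_nat l :: complex))"
    by (simp add: K_def pochhammer_Suc power2_eq_square algebra_simps)
  have g0: "pochhammer (- \<kappa>) (Suc m) * pochhammer (\<kappa> + 1) (Suc m)
     = (of_nat m - \<kappa>) * (of_nat m + \<kappa> + 1) * g"
    by (simp add: g_def pochhammer_Suc algebra_simps)
  have g1: "pochhammer (- (\<kappa> + 1)) (Suc m) * pochhammer (\<kappa> + 1 + 1) (Suc m)
     = - ((of_nat m + \<kappa> + 1) * (of_nat m + \<kappa> + 2)) * g"
  proof -
    have "(\<kappa> + 1) * pochhammer (\<kappa> + 1 + 1) (Suc m) = pochhammer (\<kappa> + 1) (Suc (Suc m))"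
      by (simp add: pochhammer_rec)
    also have "\<dots> = pochhammer (\<kappa> + 1) m * (of_nat m + \<kappa> + 1) * (of_nat m + \<kappa> + 2)"
      by (simp add: pochhammer_Suc algebra_simps)
    finally have "(\<kappa> + 1) * pochhammer (\<kappa> + 1 + 1) (Suc m) = \<dots>" .
    then show ?thesis
      unfolding pochhammer_neg_plus_one g_def by algebra
  qed
  have g2: "pochhammer (- (\<kappa> - 1)) (Suc m) * pochhammer (\<kappa> - 1 + 1) (Suc m)
     = - ((of_nat m - \<kappa>) * (of_nat m + 1 - \<kappa>)) * g"
  proof -
    have "\<kappa> * pochhammer (- (\<kappa> - 1)) (Suc m) = (\<kappa> - of_nat (Suc m)) * pochhammer (- \<kappa>) (Suc m)"
      by (rule pochhammer_neg_minus_one)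
    also have "\<dots> = (\<kappa> - of_nat m - 1) * (of_nat m - \<kappa>) * pochhammer (- \<kappa>) m"
      by (simp add: pochhammer_Suc algebra_simps)
    finally have 1: "\<kappa> * pochhammer (- (\<kappa> - 1)) (Suc m) = \<dots>" .
    have "pochhammer (\<kappa> - 1 + 1) (Suc m) = \<kappa> * pochhammer (\<kappa> + 1) m"
      by (simp add: pochhammer_rec)
    then show ?thesis using 1 unfolding g_def by algebra
  qed
  have alg: "((of_nat l - 2 * of_nat (Suc m)) * ((of_nat m - \<kappa>) * (of_nat m + \<kappa> + 1) * g)
     + (\<kappa> + 1) * (of_nat l - \<kappa>) / (2 * \<kappa> + 1) * ((of_nat m + \<kappa> + 1) * (of_nat m + \<kappa> + 2) * g)
     + \<kappa> * (\<kappa> + of_nat l + 1) / (2 * \<kappa> + 1) * ((of_nat m - \<kappa>) * (of_nat m + 1 - \<kappa>) * g))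
     = - 2 * (of_nat (Suc m) ^ 2 * (of_nat m - of_nat l)) * g" (is "?A + ?B / _ * ?C + ?D / _ * ?E = ?R")
  proof -
    have "?A * (2 * \<kappa> + 1) + ?B * ?C + ?D * ?E = ?R * (2 * \<kappa> + 1)"
      unfolding of_nat_Suc by algebra
    then have "(?A * (2 * \<kappa> + 1) + ?B * ?C + ?D * ?E) / (2 * \<kappa> + 1) = ?R"
      using nz by (simp add: nonzero_divide_eq_eq)
    then show ?thesis using nz by (simp add: add_divide_distrib)
  qed
  have R: "- 2 * hahn_coeff l \<kappa> m
     = (- 2 * (of_nat (Suc m) ^ 2 * (of_nat m - of_nat l)) * g)
         / (K * (of_nat (Suc m) ^ 2 * (of_nat m - of_nat l :: complex)))"
  proof -
    define d :: complex where "d = of_nat (Suc m) ^ 2 * (of_nat m - of_nat l)"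
    have "d \<noteq> 0" using dnz by (simp add: d_def del: of_nat_Suc)
    then show ?thesis
      unfolding hahn_coeff_def K_def[symmetric] g_def[symmetric] d_def[symmetric] by simp
  qed
  show ?thesis
    unfolding R alg[symmetric] unfolding hahn_coeff_def K g0 g1 g2
    by (simp add: add_divide_distrib diff_divide_distrib del: of_nat_Suc)
qed

text \<open>
  Multiplication by \<open>x\<close> maps \<open>pochhammer (- x) i\<close> to a combination of the functions with indices \<open>i\<close>
  and \<open>i + 1\<close>. With \<open>hahn_coeff_contiguous\<close> the sum telescopes again, and its last term
  contains \<open>pochhammer (- x) (l + 1)\<close>, which vanishes at the integers \<open>x \<le> l\<close>.
\<close>

lemma hahn_three_term:
  assumes "j \<le> l"
  shows "(of_nat l - 2 * of_nat j) * hahn l (of_nat k) (of_nat j)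
     = (of_nat k + 1) * (of_nat l - of_nat k) / (2 * of_nat k + 1) * hahn l (of_nat k + 1) (of_nat j)
     + of_nat k * (of_nat k + of_nat l + 1) / (2 * of_nat k + 1) * hahn l (of_nat k - 1) (of_nat j)"
proof -
  define \<kappa> :: complex where "\<kappa> = of_nat k"
  define x :: complex where "x = of_nat j"
  define \<alpha> where "\<alpha> = (\<kappa> + 1) * (of_nat l - \<kappa>) / (2 * \<kappa> + 1)"
  define \<beta> where "\<beta> = \<kappa> * (\<kappa> + of_nat l + 1) / (2 * \<kappa> + 1)"
  have nz: "2 * \<kappa> + 1 \<noteq> 0"
  proof -
    have "2 * \<kappa> + 1 = of_nat (2 * k + 1)" by (simp add: \<kappa>_def)
    then show ?thesis by (simp only: of_nat_eq_0_iff)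
  qed
  have ab: "\<alpha> + \<beta> = of_nat l"
    using nz unfolding \<alpha>_def \<beta>_def add_divide_distrib[symmetric]
    by (simp add: nonzero_divide_eq_eq algebra_simps)
  have partial: "N \<le> l \<Longrightarrow> (\<Sum>i\<le>N. ((of_nat l - 2 * x) * hahn_coeff l \<kappa> i
       - \<alpha> * hahn_coeff l (\<kappa> + 1) i - \<beta> * hahn_coeff l (\<kappa> - 1) i) * pochhammer (- x) i)
     = 2 * hahn_coeff l \<kappa> N * pochhammer (- x) (Suc N)" for N
  proof (induction N)
    case 0
    show ?case using ab by (simp add: hahn_coeff_def algebra_simps)
  next
    case (Suc N)
    have P: "pochhammer (- x) (Suc (Suc N)) = pochhammer (- x) (Suc N) * (of_nat (Suc N) - x)"
      by (subst pochhammer_Suc) simp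
    have c: "(of_nat l - 2 * of_nat (Suc N)) * hahn_coeff l \<kappa> (Suc N)
       - \<alpha> * hahn_coeff l (\<kappa> + 1) (Suc N) - \<beta> * hahn_coeff l (\<kappa> - 1) (Suc N)
       = - 2 * hahn_coeff l \<kappa> N"
      unfolding \<alpha>_def \<beta>_def using hahn_coeff_contiguous[OF _ nz] Suc.prems by simp
    have IH: "(\<Sum>i\<le>N. ((of_nat l - 2 * x) * hahn_coeff l \<kappa> i
       - \<alpha> * hahn_coeff l (\<kappa> + 1) i - \<beta> * hahn_coeff l (\<kappa> - 1) i) * pochhammer (- x) i)
     = 2 * hahn_coeff l \<kappa> N * pochhammer (- x) (Suc N)"
      using Suc by simp
    show ?case
      unfolding sum.atMost_Suc IH P using c by algebra
  qed
  have "pochhammer (- x) (Suc l) = 0"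
    using assms by (simp add: x_def pochhammer_of_nat_eq_0_iff)
  with partial[of l] have "(\<Sum>i\<le>l. ((of_nat l - 2 * x) * hahn_coeff l \<kappa> i
       - \<alpha> * hahn_coeff l (\<kappa> + 1) i - \<beta> * hahn_coeff l (\<kappa> - 1) i) * pochhammer (- x) i) = 0"
    by simp
  then have "(of_nat l - 2 * x) * hahn l \<kappa> x - \<alpha> * hahn l (\<kappa> + 1) x - \<beta> * hahn l (\<kappa> - 1) x = 0"
    by (simp only: hahn_def sum_distrib_left left_diff_distrib mult.assoc sum_subtractf)
  then show ?thesis
    unfolding \<alpha>_def \<beta>_def \<kappa>_def x_def by (simp only: diff_diff_eq right_minus_eq)
qed

section \<open>The matrices of \<open>D\<close> and \<open>E\<close> in the basis of the columns of \<open>U\<close>\<close>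

text \<open>
  The index \<open>k\<close> is arbitrary: the column \<open>l + 1\<close>, which the recurrences mention with the factor \<open>0\<close>,
  is covered as well.
\<close>

lemma U_mat_eq_hahn:
  assumes "j \<le> l"
  shows "U_mat l j k = hahn l (of_nat k) (of_nat j)"
proof -
  let ?t = "\<lambda>i. fps_nth (fps_hypergeo [- of_nat k, - of_nat j, of_nat k + 1] [1, - of_nat l] 1) i * 1 ^ i
     :: complex"
  have t: "?t i = hahn_coeff l (of_nat k) i * pochhammer (- of_nat j) i" for i
    by (simp add: hahn_coeff_def pochhammer_fact[symmetric] power2_eq_square mult.commute
        mult.left_commute)
  have "?t i = 0" if "i \<notin> {..l}" for i
    unfolding t using that assms by (simp add: pochhammer_of_nat_eq_0_iff)
  then have "suminf ?t = sum ?t {..l}"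
    by (intro suminf_finite) auto
  then show ?thesis
    by (simp only: U_mat_def hypergeometric_def eval_fps_def t hahn_def)
qed

lemma mat_vec_add: "mat_vec l (\<lambda>r s. M r s + N r s) x j = mat_vec l M x j + mat_vec l N x j"
  by (simp add: mat_vec_def algebra_simps sum.distrib)

lemma mat_vec_diff: "mat_vec l (\<lambda>r s. M r s - N r s) x j = mat_vec l M x j - mat_vec l N x j"
  by (simp add: mat_vec_def algebra_simps sum_subtractf)

lemma mat_vec_sum_matrix_unit:
  assumes "finite A" "\<And>r. r \<in> A \<Longrightarrow> f r \<le> l"
  shows "mat_vec l (\<lambda>r s. \<Sum>j\<in>A. c j * matrix_unit j (f j) r s) x r
       = (if r \<in> A then c r * x (f r) else 0)"
proof -
  have "(\<Sum>j\<in>A. c j * matrix_unit j (f j) r s) = (if r \<in> A \<and> s = f r then c r else 0)" for s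
  proof -
    have "(\<Sum>j\<in>A. c j * matrix_unit j (f j) r s)
        = (\<Sum>j\<in>A. if r = j then (if s = f r then c r else 0) else 0)"
      by (rule sum.cong) (auto simp: matrix_unit_def)
    then show ?thesis using assms(1) by simp
  qed
  then have "mat_vec l (\<lambda>r s. \<Sum>j\<in>A. c j * matrix_unit j (f j) r s) x r
     = (\<Sum>s\<le>l. if s = f r then (if r \<in> A then c r * x (f r) else 0) else 0)"
    unfolding mat_vec_def by (intro sum.cong) auto
  then show ?thesis using assms(2) by auto
qed

lemma mat_vec_A0: "j \<le> l \<Longrightarrow> mat_vec l (A0 l) x j = (of_nat l - 2 * of_nat j) * x j"
  unfolding A0_def by (subst mat_vec_sum_matrix_unit) auto

lemma mat_vec_T_mat: "j \<le> l \<Longrightarrow> mat_vec l (T_mat l u) x j = of_real (sqrt (1 - u^2) ^ j) * x j"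
  unfolding T_mat_def by (subst mat_vec_sum_matrix_unit) auto

lemma mat_vec_C0:
  assumes "j \<le> l"
  shows "mat_vec l (C0 l) x j = of_nat j * (of_nat l - of_nat j + 1) * (x (j - 1) - x j)"
proof (cases "j = 0")
  case True
  then show ?thesis
    unfolding C0_def right_diff_distrib sum_subtractf mat_vec_diff
    by (subst (1 2) mat_vec_sum_matrix_unit) auto
next
  case False
  with assms show ?thesis
    unfolding C0_def right_diff_distrib sum_subtractf mat_vec_diff
    by (subst (1 2) mat_vec_sum_matrix_unit) (auto simp: algebra_simps)
qed

lemma mat_vec_C1:
  assumes "j \<le> l"
  shows "mat_vec l (C1 l) x j = (of_nat j + 1) * (of_nat l - of_nat j) * (x (j + 1) - x j)"
proof (cases "j = l")
  case True
  then show ?thesis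
    unfolding C1_def right_diff_distrib sum_subtractf mat_vec_diff
    by (subst (1 2) mat_vec_sum_matrix_unit) auto
next
  case False
  with assms show ?thesis
    unfolding C1_def right_diff_distrib sum_subtractf mat_vec_diff
    by (subst (1 2) mat_vec_sum_matrix_unit) (auto simp: algebra_simps)
qed

text \<open>
  The coefficients with which \<open>A\<^sub>0\<close> maps a column of \<open>U\<close> to the next and to the previous column.
\<close>

definition up_coeff :: "nat \<Rightarrow> nat \<Rightarrow> complex" where
  "up_coeff l k = (of_nat k + 1) * (of_nat l - of_nat k) / (2 * of_nat k + 1)"

definition down_coeff :: "nat \<Rightarrow> nat \<Rightarrow> complex" where
  "down_coeff l k = of_nat k * (of_nat k + of_nat l + 1) / (2 * of_nat k + 1)"

lemma up_coeff_self [simp]: "up_coeff l l = 0"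
  by (simp add: up_coeff_def)

lemma down_coeff_0 [simp]: "down_coeff l 0 = 0"
  by (simp add: down_coeff_def)

definition C_sum :: "nat \<Rightarrow> cmat" where
  "C_sum l = (\<lambda>r s. C0 l r s + C1 l r s)"

lemma mat_vec_C_sum:
  "j \<le> l \<Longrightarrow> mat_vec l (C_sum l) x j = of_nat j * (of_nat l - of_nat j + 1) * (x (j - 1) - x j)
     + (of_nat j + 1) * (of_nat l - of_nat j) * (x (j + 1) - x j)"
  by (simp add: C_sum_def mat_vec_add mat_vec_C0 mat_vec_C1)

lemma mat_vec_cong: "(\<And>j. j \<le> l \<Longrightarrow> x j = y j) \<Longrightarrow> mat_vec l M x i = mat_vec l M y i"
  by (simp add: mat_vec_def)

lemma mat_vec_linear:
  "mat_vec l M (\<lambda>j. a * x j + b * y j) i = a * mat_vec l M x i + b * mat_vec l M y i"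
  by (simp add: mat_vec_def algebra_simps sum.distrib sum_distrib_left)

lemma mat_vec_sum:
  "mat_vec l M (\<lambda>j. \<Sum>k\<in>A. f j k * c k) i = (\<Sum>k\<in>A. mat_vec l M (\<lambda>j. f j k) i * c k)"
  unfolding mat_vec_def sum_distrib_left sum_distrib_right
  by (subst sum.swap) (simp add: mult.assoc)

lemma C_sum_column:
  assumes "j \<le> l" "k \<le> l"
  shows "mat_vec l (C_sum l) (\<lambda>i. U_mat l i k) j = - (of_nat k * (of_nat k + 1)) * U_mat l j k"
proof -
  let ?h = "hahn l (of_nat k)"
  have 1: "of_nat j * (U_mat l (j - 1) k - U_mat l j k)
      = of_nat j * (?h (of_nat j - 1) - ?h (of_nat j))"
    using assms by (cases "j = 0") (simp_all add: U_mat_eq_hahn of_nat_diff)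
  have 2: "(of_nat l - of_nat j) * (U_mat l (j + 1) k - U_mat l j k)
      = (of_nat l - of_nat j) * (?h (of_nat j + 1) - ?h (of_nat j))"
    using assms by (cases "j = l") (simp_all add: U_mat_eq_hahn add.commute)
  have "mat_vec l (C_sum l) (\<lambda>i. U_mat l i k) j = hahn_op l ?h (of_nat j)"
    unfolding mat_vec_C_sum[OF assms(1)] hahn_op_def using 1 2 by algebra
  then show ?thesis
    using hahn_difference_equation[OF assms(2)] U_mat_eq_hahn[OF assms(1)] by simp
qed

lemma A0_column:
  assumes "j \<le> l"
  shows "(of_nat l - 2 * of_nat j) * U_mat l j k
     = up_coeff l k * U_mat l j (k + 1) + down_coeff l k * U_mat l j (k - 1)"
proof -
  have *: "down_coeff l k * hahn l (of_nat (k - 1)) (of_nat j)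
      = down_coeff l k * hahn l (of_nat k - 1) (of_nat j)"
    by (cases "k = 0") (simp_all add: of_nat_diff)
  show ?thesis
    unfolding U_mat_eq_hahn[OF assms] * of_nat_add of_nat_1
    unfolding up_coeff_def down_coeff_def by (rule hahn_three_term[OF assms])
qed

text \<open>
  The identity \<open>C\<^sub>1 - C\<^sub>0 = - 1/2 [C\<^sub>0 + C\<^sub>1, A\<^sub>0] - A\<^sub>0\<close>: commuting with the diagonal matrix \<open>A\<^sub>0\<close>
  multiplies the two off-diagonals of \<open>C\<^sub>0 + C\<^sub>1\<close> by \<open>2\<close> and \<open>- 2\<close>, and the diagonal of \<open>C\<^sub>1 - C\<^sub>0\<close>
  is \<open>- A\<^sub>0\<close>.
\<close>

lemma C_diff_commutator:
  assumes "j \<le> l"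
  shows "mat_vec l (\<lambda>r s. C1 l r s - C0 l r s) x j
     = - (1/2) * (mat_vec l (C_sum l) (\<lambda>i. (of_nat l - 2 * of_nat i) * x i) j
                  - (of_nat l - 2 * of_nat j) * mat_vec l (C_sum l) x j)
       - (of_nat l - 2 * of_nat j) * x j"
proof -
  have 1: "of_nat j * ((of_nat l - 2 * of_nat (j - 1)) * x (j - 1))
      = of_nat j * ((of_nat l - 2 * of_nat j + 2) * x (j - 1))"
    by (cases "j = 0") (simp_all add: of_nat_diff)
  have "mat_vec l (C_sum l) (\<lambda>i. (of_nat l - 2 * of_nat i) * x i) j =
     (of_nat l - of_nat j + 1) * (of_nat j * ((of_nat l - 2 * of_nat (j - 1)) * x (j - 1)))
     - of_nat j * (of_nat l - of_nat j + 1) * ((of_nat l - 2 * of_nat j) * x j)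
     + (of_nat j + 1) * (of_nat l - of_nat j)
        * ((of_nat l - 2 * of_nat j - 2) * x (j + 1) - (of_nat l - 2 * of_nat j) * x j)"
    unfolding mat_vec_C_sum[OF assms] by (simp add: algebra_simps)
  then have 2: "mat_vec l (C_sum l) (\<lambda>i. (of_nat l - 2 * of_nat i) * x i) j =
     of_nat j * (of_nat l - of_nat j + 1)
       * ((of_nat l - 2 * of_nat j + 2) * x (j - 1) - (of_nat l - 2 * of_nat j) * x j)
     + (of_nat j + 1) * (of_nat l - of_nat j)
        * ((of_nat l - 2 * of_nat j - 2) * x (j + 1) - (of_nat l - 2 * of_nat j) * x j)"
    unfolding 1 by (simp add: algebra_simps)
  show ?thesis
    unfolding 2 mat_vec_C_sum[OF assms] mat_vec_diff mat_vec_C0[OF assms] mat_vec_C1[OF assms]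
    by (simp add: field_simps)
qed

text \<open>
  Column \<open>k\<close> being an eigenvector of \<open>C\<^sub>0 + C\<^sub>1\<close>, the commutator multiplies each neighbour that \<open>A\<^sub>0\<close>
  produces by the difference of the two eigenvalues.
\<close>

lemma C_diff_column:
  assumes "j \<le> l" "k \<le> l"
  shows "mat_vec l (\<lambda>r s. C1 l r s - C0 l r s) (\<lambda>i. U_mat l i k) j
     = of_nat k * up_coeff l k * U_mat l j (k + 1)
       - (of_nat k + 1) * down_coeff l k * U_mat l j (k - 1)"
proof -
  have "mat_vec l (C_sum l) (\<lambda>i. (of_nat l - 2 * of_nat i) * U_mat l i k) j
     = mat_vec l (C_sum l)
         (\<lambda>i. up_coeff l k * U_mat l i (k + 1) + down_coeff l k * U_mat l i (k - 1)) j"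
    using A0_column by (intro mat_vec_cong) blast
  also have "\<dots> = up_coeff l k * mat_vec l (C_sum l) (\<lambda>i. U_mat l i (k + 1)) j
      + down_coeff l k * mat_vec l (C_sum l) (\<lambda>i. U_mat l i (k - 1)) j"
    by (rule mat_vec_linear)
  also have "up_coeff l k * mat_vec l (C_sum l) (\<lambda>i. U_mat l i (k + 1)) j
      = - ((of_nat k + 1) * (of_nat k + 2)) * (up_coeff l k * U_mat l j (k + 1))"
    using assms C_sum_column[of j l "k + 1"] by (cases "k = l") (simp_all add: add.commute)
  also have "down_coeff l k * mat_vec l (C_sum l) (\<lambda>i. U_mat l i (k - 1)) j
      = - ((of_nat k - 1) * of_nat k) * (down_coeff l k * U_mat l j (k - 1))"
    using assms C_sum_column[of j l "k - 1"] by (cases "k = 0") (simp_all add: of_nat_diff)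
  finally show ?thesis
    unfolding C_diff_commutator[OF assms(1)] C_sum_column[OF assms] 
    using A0_column[OF assms(1), of k] by (simp add: algebra_simps)
qed

text \<open>
  Summation by parts turns the bilinear form of \<open>C\<^sub>0 + C\<^sub>1\<close> into a Dirichlet form; this shows that
  the matrix is symmetric.
\<close>

lemma sum_C_sum_mult:
  "(\<Sum>j\<le>l. mat_vec l (C_sum l) x j * y j)
   = - (\<Sum>j<l. (of_nat j + 1) * (of_nat l - of_nat j) * ((x (j + 1) - x j) * (y (j + 1) - y j)))"
proof -
  have "(\<Sum>j\<le>l. mat_vec l (C_sum l) x j * y j)
      = (\<Sum>j\<le>l. of_nat j * (of_nat l - of_nat j + 1) * (x (j - 1) - x j) * y j)
        + (\<Sum>j\<le>l. (of_nat j + 1) * (of_nat l - of_nat j) * (x (j + 1) - x j) * y j)"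
    by (simp add: mat_vec_C_sum sum.distrib distrib_right)
  also have "(\<Sum>j\<le>l. of_nat j * (of_nat l - of_nat j + 1) * (x (j - 1) - x j) * y j)
      = (\<Sum>j<l. (of_nat j + 1) * (of_nat l - of_nat j) * (x j - x (j + 1)) * y (j + 1))"
    by (subst sum.atMost_shift) (simp add: add.commute)
  also have "(\<Sum>j\<le>l. (of_nat j + 1) * (of_nat l - of_nat j) * (x (j + 1) - x j) * y j)
      = (\<Sum>j<l. (of_nat j + 1) * (of_nat l - of_nat j) * (x (j + 1) - x j) * y j)"
    by (simp add: lessThan_Suc_atMost[symmetric])
  finally show ?thesis
    unfolding sum.distrib[symmetric] sum_negf[symmetric]
    by (simp add: algebra_simps)
qed

lemma U_mat_columns_orthogonal:
  assumes "k \<le> l" "m \<le> l" "k \<noteq> m"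
  shows "(\<Sum>j\<le>l. U_mat l j k * U_mat l j m) = 0"
proof -
  define P where "P = (\<Sum>j\<le>l. U_mat l j k * U_mat l j m)"
  have "- (of_nat k * (of_nat k + 1)) * P
      = (\<Sum>j\<le>l. mat_vec l (C_sum l) (\<lambda>i. U_mat l i k) j * U_mat l j m)"
    unfolding P_def sum_distrib_left using assms by (intro sum.cong) (simp_all add: C_sum_column)
  also have "\<dots> = (\<Sum>j\<le>l. mat_vec l (C_sum l) (\<lambda>i. U_mat l i m) j * U_mat l j k)"
    unfolding sum_C_sum_mult by (simp add: mult.commute)
  also have "\<dots> = - (of_nat m * (of_nat m + 1)) * P"
    unfolding P_def sum_distrib_left using assms
    by (intro sum.cong) (simp_all add: C_sum_column mult.commute mult.left_commute)
  finally have "(of_nat (m * (m + 1)) - of_nat (k * (k + 1)) :: complex) * P = 0"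
    by (simp add: algebra_simps)
  moreover have "m * (m + 1) \<noteq> k * (k + 1)"
  proof -
    have "a * (a + 1) < b * (b + 1)" if "a < b" for a b :: nat
      using that by (intro mult_strict_mono) auto
    then show ?thesis using assms(3) by (metis linorder_neqE_nat less_irrefl)
  qed
  ultimately show ?thesis
    unfolding P_def by (simp only: mult_eq_0_iff right_minus_eq of_nat_eq_iff) blast
qed

lemma hahn_coeff_diag_nonzero:
  assumes "k \<le> l"
  shows "hahn_coeff l (of_nat k) k \<noteq> 0"
proof -
  have "of_nat k + 1 \<noteq> - (of_nat i :: complex)" for i
  proof
    assume "of_nat k + 1 = - (of_nat i :: complex)"
    then have "(of_nat (k + 1 + i) :: complex) = - of_nat i + of_nat i"
      by (simp only: of_nat_add of_nat_1)
    then show False by (simp only: ab_left_minus of_nat_eq_0_iff)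
  qed
  then have "pochhammer (of_nat k + 1 :: complex) k \<noteq> 0"
    unfolding pochhammer_eq_0_iff by blast
  moreover have "pochhammer (- of_nat k :: complex) k \<noteq> 0"
    by (rule pochhammer_neg_of_nat_nonzero) simp
  ultimately show ?thesis
    using pochhammer_neg_of_nat_nonzero[OF assms] by (simp add: hahn_coeff_def)
qed

text \<open>
  \<open>U\<close> is the product of a lower triangular matrix, with entries \<open>pochhammer (- j) i\<close>, and an upper
  triangular matrix of coefficients, both with nonzero diagonal. A vector orthogonal to all columns
  is thus killed by two successive triangular eliminations.
\<close>

lemma U_mat_transpose_injective:
  assumes zero: "\<And>k. k \<le> l \<Longrightarrow> (\<Sum>j\<le>l. x j * U_mat l j k) = 0" and "j \<le> l"
  shows "x j = 0"
proof -
  define y where "y i = (\<Sum>j\<le>l. x j * pochhammer (- of_nat j) i)" for i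
  have y0: "y k = 0" if "k \<le> l" for k
    using that
  proof (induction k rule: less_induct)
    case (less k)
    have "0 = (\<Sum>j\<le>l. x j * (\<Sum>i\<le>l. hahn_coeff l (of_nat k) i * pochhammer (- of_nat j) i))"
      using zero[OF less.prems] by (simp add: U_mat_eq_hahn hahn_def)
    also have "\<dots> = (\<Sum>i\<le>l. hahn_coeff l (of_nat k) i * y i)"
      unfolding y_def sum_distrib_left by (subst sum.swap) (simp add: mult.left_commute)
    also have "\<dots> = (\<Sum>i\<in>{k}. hahn_coeff l (of_nat k) i * y i)"
    proof (rule sum.mono_neutral_right)
      show "\<forall>i\<in>{..l} - {k}. hahn_coeff l (of_nat k) i * y i = 0"
      proof
        fix i assume i: "i \<in> {..l} - {k}"
        show "hahn_coeff l (of_nat k) i * y i = 0"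
        proof (cases "i < k")
          case True
          then show ?thesis using less by simp
        next
          case False
          then have "pochhammer (- of_nat k :: complex) i = 0"
            using i by (simp add: pochhammer_of_nat_eq_0_iff)
          then show ?thesis by (simp add: hahn_coeff_def)
        qed
      qed
    qed (use less.prems in auto)
    finally show ?case using hahn_coeff_diag_nonzero[OF less.prems] by simp
  qed
  show ?thesis
    using assms(2)
  proof (induction j rule: measure_induct_rule[of "\<lambda>j. l - j"])
    case (less j)
    have "y j = (\<Sum>i\<in>{j}. x i * pochhammer (- of_nat i) j)"
      unfolding y_def
    proof (rule sum.mono_neutral_right)
      show "\<forall>i\<in>{..l} - {j}. x i * pochhammer (- of_nat i) j = 0"
      proof
        fix i assume i: "i \<in> {..l} - {j}"
        show "x i * pochhammer (- of_nat i) j = 0"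
        proof (cases "i < j")
          case True
          then show ?thesis by (simp add: pochhammer_of_nat_eq_0_iff)
        next
          case False
          then have "l - i < l - j" "i \<le> l" using i by auto
          then show ?thesis using less.IH by simp
        qed
      qed
    qed (use less.prems in auto)
    then show ?case
      using y0[OF less.prems] pochhammer_neg_of_nat_nonzero[of j j] by simp
  qed
qed

lemma U_mat_first_row: "U_mat l 0 k = 1"
proof -
  have "hahn_coeff l (of_nat k) i * pochhammer (0 :: complex) i = (if i = 0 then 1 else 0)" for i
    by (simp add: hahn_coeff_def pochhammer_0_left)
  then show ?thesis by (simp add: U_mat_eq_hahn hahn_def)
qed

lemma U_mat_first_column: "j \<le> l \<Longrightarrow> U_mat l j 0 = 1"
proof -
  assume "j \<le> l"
  moreover have "hahn_coeff l 0 i * pochhammer (- of_nat j) i = (if i = 0 then 1 else 0)" for i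
    by (simp add: hahn_coeff_def pochhammer_0_left)
  ultimately show ?thesis by (simp add: U_mat_eq_hahn hahn_def)
qed

text \<open>
  The sum has no complex conjugates, so it could vanish for a nonzero vector. It does not: a column
  orthogonal to itself would be orthogonal to all columns, hence zero, but its first entry is \<open>1\<close>.
\<close>

lemma U_mat_column_norm_nonzero:
  assumes "k \<le> l"
  shows "(\<Sum>j\<le>l. U_mat l j k * U_mat l j k) \<noteq> 0"
proof
  assume "(\<Sum>j\<le>l. U_mat l j k * U_mat l j k) = 0"
  then have "(\<Sum>j\<le>l. U_mat l j k * U_mat l j m) = 0" if "m \<le> l" for m
    using U_mat_columns_orthogonal[OF assms that] by (cases "m = k") auto
  then have "U_mat l 0 k = 0" by (rule U_mat_transpose_injective) auto
  then show False by (simp add: U_mat_first_row)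
qed

text \<open>
  The transpose of \<open>U\<close> with row \<open>k\<close> divided by the squared length of column \<open>k\<close>.
\<close>

definition U_inv :: "nat \<Rightarrow> cmat" where
  "U_inv l = (\<lambda>k j. U_mat l j k / (\<Sum>i\<le>l. U_mat l i k * U_mat l i k))"

lemma U_inv_left:
  assumes "k \<le> l"
  shows "mat_vec l (U_inv l) (mat_vec l (U_mat l) y) k = y k"
proof -
  define d where "d = (\<Sum>i\<le>l. U_mat l i k * U_mat l i k)"
  have "mat_vec l (U_inv l) (mat_vec l (U_mat l) y) k
      = (\<Sum>m\<le>l. (\<Sum>j\<le>l. U_mat l j k * U_mat l j m) / d * y m)"
    unfolding mat_vec_def U_inv_def d_def[symmetric] sum_divide_distrib sum_distrib_left sum_distrib_right
    by (subst sum.swap) (simp add: mult.assoc)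
  also have "\<dots> = (\<Sum>m\<in>{k}. (\<Sum>j\<le>l. U_mat l j k * U_mat l j m) / d * y m)"
    using assms U_mat_columns_orthogonal[OF assms]
    by (intro sum.mono_neutral_right) auto
  also have "\<dots> = y k"
    using U_mat_column_norm_nonzero[OF assms] by (simp add: d_def)
  finally show ?thesis .
qed

lemma U_mat_injective:
  assumes "\<And>j. j \<le> l \<Longrightarrow> mat_vec l (U_mat l) y j = 0" and "k \<le> l"
  shows "y k = 0"
proof -
  have "y k = mat_vec l (U_inv l) (mat_vec l (U_mat l) y) k"
    by (simp add: U_inv_left assms(2))
  also have "\<dots> = mat_vec l (U_inv l) (\<lambda>_. 0) k"
    using assms(1) by (intro mat_vec_cong) simp
  finally show ?thesis by (simp add: mat_vec_def)
qed

text \<open>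
  The difference of the two sides is orthogonal to all columns.
\<close>

lemma U_inv_right:
  assumes "j \<le> l"
  shows "mat_vec l (U_mat l) (mat_vec l (U_inv l) x) j = x j"
proof -
  define z where "z = (\<lambda>j. x j - mat_vec l (U_mat l) (mat_vec l (U_inv l) x) j)"
  have Vz: "mat_vec l (U_inv l) z k = 0" if "k \<le> l" for k
    using U_inv_left[OF that, of "mat_vec l (U_inv l) x"]
      mat_vec_linear[of l "U_inv l" 1 x "-1" "mat_vec l (U_mat l) (mat_vec l (U_inv l) x)" k]
    by (simp add: z_def)
  have "(\<Sum>i\<le>l. z i * U_mat l i k) = 0" if "k \<le> l" for k
  proof -
    have "(\<Sum>i\<le>l. z i * U_mat l i k) / (\<Sum>i\<le>l. U_mat l i k * U_mat l i k) = 0"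
      using Vz[OF that] by (simp add: mat_vec_def U_inv_def sum_divide_distrib mult.commute)
    then show ?thesis using U_mat_column_norm_nonzero[OF that] by simp
  qed
  then have "z j = 0" by (rule U_mat_transpose_injective) (use assms in auto)
  then show ?thesis by (simp add: z_def)
qed

section \<open>The hypergeometric equation\<close>

lemma fps_hypergeo_2_1_Suc:
  fixes a b c :: complex
  assumes "\<And>m. c + of_nat m \<noteq> 0"
  shows "(c + of_nat m) * of_nat (Suc m) * fps_nth (fps_hypergeo [a, b] [c] 1) (Suc m)
    = (a + of_nat m) * (b + of_nat m) * fps_nth (fps_hypergeo [a, b] [c] 1) m"
proof -
  have cancel: "d * s * (p * q / (s * d) * f) = p * q * f" if "d \<noteq> 0" "s \<noteq> 0" for d s p q f :: complex
    using that by simp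
  show ?thesis
    unfolding fps_hypergeo_rec foldl.simps mult_1
    by (rule cancel) (use assms of_nat_neq_0 in auto)
qed

lemma ratio_shift_tendsto_1:
  fixes a c :: complex
  assumes "\<And>m. c + of_nat m \<noteq> 0"
  shows "(\<lambda>m. (a + of_nat m) / (c + of_nat m)) \<longlonglongrightarrow> 1"
proof -
  have "filterlim (\<lambda>m. c + of_nat m) at_infinity sequentially"
    by (intro tendsto_add_filterlim_at_infinity[OF tendsto_const] tendsto_of_nat)
  then have "(\<lambda>m. 1 + (a - c) / (c + of_nat m)) \<longlonglongrightarrow> 1 + 0"
    by (intro tendsto_add tendsto_const tendsto_divide_0[OF tendsto_const])
  moreover have "1 + (a - c) / (c + of_nat m) = (a + of_nat m) / (c + of_nat m)" for m
    using assms[of m] by (simp add: field_simps)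
  ultimately show ?thesis by simp
qed

text \<open>
  The ratio of successive coefficients tends to \<open>1\<close>. The ratio test is used in the form that allows
  zero coefficients, because the series may terminate.
\<close>

lemma fps_hypergeo_2_1_conv_radius:
  fixes a b c :: complex
  assumes c: "\<And>m. c + of_nat m \<noteq> 0"
  shows "fps_conv_radius (fps_hypergeo [a, b] [c] 1) \<ge> 1"
  unfolding fps_conv_radius_def
proof (rule conv_radius_geI_ex')
  fix r :: real assume r: "0 < r" "ereal r < 1"
  define f where "f m = fps_nth (fps_hypergeo [a, b] [c] 1) m * of_real r ^ m" for m
  define q where "q m = (a + of_nat m) / (c + of_nat m) * ((b + of_nat m) / (1 + of_nat m)) * of_real r" for m
  have one: "1 + of_nat m \<noteq> (0 :: complex)" for m
    using of_nat_neq_0[of m] by simp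
  have "q \<longlonglongrightarrow> 1 * 1 * of_real r"
    unfolding q_def
    by (intro tendsto_mult tendsto_const ratio_shift_tendsto_1 c one)
  then have "(\<lambda>m. norm (q m)) \<longlonglongrightarrow> r"
    using tendsto_norm[of q "of_real r"] r by simp
  moreover have "r < (1 + r) / 2" using r by (simp add: one_ereal_def)
  ultimately have "eventually (\<lambda>m. norm (q m) < (1 + r) / 2) sequentially"
    by (rule order_tendstoD)
  then obtain N where N: "\<And>m. m \<ge> N \<Longrightarrow> norm (q m) < (1 + r) / 2"
    by (auto simp: eventually_sequentially)
  have Suc: "f (Suc m) = q m * f m" for m
  proof -
    have "(c + of_nat m) * of_nat (Suc m) * f (Suc m) = (a + of_nat m) * (b + of_nat m) * of_real r * f m"
      unfolding f_def using fps_hypergeo_2_1_Suc[OF c, of m a b]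
      by (simp add: algebra_simps del: fps_hypergeo_nth of_nat_Suc)
    then show ?thesis
      using c[of m] of_nat_neq_0[where 'a = complex, of m] by (simp add: q_def nonzero_eq_divide_eq ac_simps)
  qed
  have "summable f"
  proof (rule summable_ratio_test)
    show "(1 + r) / 2 < 1" using r by (simp add: one_ereal_def)
    show "norm (f (Suc m)) \<le> (1 + r) / 2 * norm (f m)" if "m \<ge> N" for m
      unfolding Suc norm_mult using N[OF that] by (intro mult_right_mono) auto
  qed
  then show "summable (\<lambda>m. fps_nth (fps_hypergeo [a, b] [c] 1) m * of_real r ^ m)"
    by (simp add: f_def[abs_def])
qed

lemma fps_hypergeo_2_1_ode:
  fixes a b c :: complex
  assumes c: "\<And>m. c + of_nat m \<noteq> 0"
  defines "F \<equiv> fps_hypergeo [a, b] [c] 1"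
  shows "fps_X * fps_deriv (fps_deriv F) + fps_const c * fps_deriv F
     = fps_X * (fps_X * fps_deriv (fps_deriv F)) + fps_const (a + b + 1) * (fps_X * fps_deriv F)
       + fps_const (a * b) * F" (is "?L = ?R")
proof (rule fps_ext)
  fix m
  have rec: "(c + of_nat m) * of_nat (Suc m) * fps_nth F (Suc m)
    = (a + of_nat m) * (b + of_nat m) * fps_nth F m"
    unfolding F_def by (rule fps_hypergeo_2_1_Suc[OF c])
  have "fps_nth ?L m = (c + of_nat m) * of_nat (Suc m) * fps_nth F (Suc m)"
    by (cases m) (simp_all add: algebra_simps)
  moreover have "fps_nth ?R m = (a + of_nat m) * (b + of_nat m) * fps_nth F m"
  proof (cases m)
    case (Suc i)
    then show ?thesis by (cases i) (simp_all add: algebra_simps)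
  qed simp
  ultimately show "fps_nth ?L m = fps_nth ?R m" using rec by simp
qed

lemma eval_fps_hypergeo_2_1_ode:
  fixes a b c z :: complex
  assumes c: "\<And>m. c + of_nat m \<noteq> 0" and z: "norm z < 1"
  defines "F \<equiv> fps_hypergeo [a, b] [c] 1"
  shows "z * (1 - z) * eval_fps (fps_deriv (fps_deriv F)) z
    + (c - (a + b + 1) * z) * eval_fps (fps_deriv F) z - a * b * eval_fps F z = 0"
proof -
  define conv where "conv f \<longleftrightarrow> ereal (norm z) < fps_conv_radius f" for f :: "complex fps"
  have F: "conv F"
    unfolding conv_def F_def
    using less_le_trans[OF _ fps_hypergeo_2_1_conv_radius[OF c]] z by (simp add: one_ereal_def)
  have der: "conv f \<Longrightarrow> conv (fps_deriv f)" for f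
    unfolding conv_def by (meson fps_conv_radius_deriv less_le_trans)
  have mult: "conv f \<Longrightarrow> conv g \<Longrightarrow> conv (f * g)" for f g
    unfolding conv_def using fps_conv_radius_mult[of f g]
    by (metis less_le_trans min_less_iff_conj)
  have add: "conv f \<Longrightarrow> conv g \<Longrightarrow> conv (f + g)" for f g
    unfolding conv_def using fps_conv_radius_add[of f g]
    by (metis less_le_trans min_less_iff_conj)
  have base: "conv fps_X" "conv (fps_const r)" for r
    by (simp_all add: conv_def)
  have ev_mult: "conv f \<Longrightarrow> conv g \<Longrightarrow> eval_fps (f * g) z = eval_fps f z * eval_fps g z" for f g
    unfolding conv_def by (rule eval_fps_mult)
  have ev_add: "conv f \<Longrightarrow> conv g \<Longrightarrow> eval_fps (f + g) z = eval_fps f z + eval_fps g z" for f g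
    unfolding conv_def by (rule eval_fps_add)
  have "eval_fps (fps_X * fps_deriv (fps_deriv F) + fps_const c * fps_deriv F) z
     = eval_fps (fps_X * (fps_X * fps_deriv (fps_deriv F)) + fps_const (a + b + 1) * (fps_X * fps_deriv F)
       + fps_const (a * b) * F) z"
    unfolding F_def fps_hypergeo_2_1_ode[OF c] ..
  then show ?thesis
    by (simp add: ev_mult ev_add F der mult add base algebra_simps)
qed

lemma has_vector_derivative_eval_fps_half:
  assumes "\<bar>1 - u\<bar> < 2" "fps_conv_radius f \<ge> 1"
  shows "((\<lambda>u. eval_fps f (of_real ((1 - u) / 2))) has_vector_derivative
     - (1/2) * eval_fps (fps_deriv f) (of_real ((1 - u) / 2) :: complex)) (at u)"
proof -
  have "norm (of_real ((1 - u) / 2) :: complex) < 1"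
    using assms(1) by (simp only: norm_of_real) simp
  then have "ereal (norm (of_real ((1 - u) / 2) :: complex)) < fps_conv_radius f"
    using assms(2) by (metis ereal_less(3) less_le_trans)
  then have 1: "(eval_fps f has_field_derivative eval_fps (fps_deriv f) (of_real ((1 - u) / 2)))
      (at (of_real ((1 - u) / 2)))"
    by (rule has_field_derivative_eval_fps)
  have "((\<lambda>u. (1 - u) / 2) has_real_derivative (- 1 / 2)) (at u)"
    by (auto intro!: derivative_eq_intros)
  then have 2: "((\<lambda>u. of_real ((1 - u) / 2) :: complex) has_vector_derivative of_real (- 1 / 2)) (at u)"
    by (rule has_vector_derivative_of_real)
  from field_vector_diff_chain_at[OF 2 1] show ?thesis by (simp add: o_def)
qed

definition gegenbauer_fps :: "complex \<Rightarrow> nat \<Rightarrow> complex fps" where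
  "gegenbauer_fps n k = fps_hypergeo [- n + of_nat k, n + of_nat k + 2] [of_nat k + 3/2] 1"

text \<open>
  The \<open>d\<close>-th derivative with respect to \<open>u\<close> of the hypergeometric function at \<open>(1 - u) / 2\<close>; the factor
  \<open>- 1/2\<close> comes from the chain rule. For \<open>d = 0\<close> this is the Gegenbauer function of degree
  \<open>n - k\<close> and order \<open>k + 1\<close>, normalized at \<open>u = 1\<close>.
\<close>

definition gegenbauer :: "complex \<Rightarrow> nat \<Rightarrow> nat \<Rightarrow> real \<Rightarrow> complex" where
  "gegenbauer n k d u = (- (1/2)) ^ d * eval_fps ((fps_deriv ^^ d) (gegenbauer_fps n k)) (of_real ((1 - u) / 2))"

lemma half_integer_nonzero: "of_nat k + 3/2 + of_nat m \<noteq> (0 :: complex)"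
proof
  assume "of_nat k + 3/2 + of_nat m = (0 :: complex)"
  then have "Re (of_nat k + 3/2 + of_nat m) = Re 0" by (rule arg_cong)
  then show False by simp
qed

lemma gegenbauer_has_vector_derivative:
  assumes "\<bar>1 - u\<bar> < 2"
  shows "(gegenbauer n k d has_vector_derivative gegenbauer n k (Suc d) u) (at u)"
proof -
  have "fps_conv_radius ((fps_deriv ^^ d) (gegenbauer_fps n k)) \<ge> 1"
  proof (induction d)
    case 0
    show ?case
      using fps_hypergeo_2_1_conv_radius[OF half_integer_nonzero] by (simp add: gegenbauer_fps_def)
  next
    case (Suc d)
    then show ?case using fps_conv_radius_deriv order_trans by fastforce
  qed
  from has_vector_derivative_mult_right[OF has_vector_derivative_eval_fps_half[OF assms this]]
  show ?thesis by (simp add: gegenbauer_def[abs_def] mult.assoc mult.left_commute)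
qed

lemma gegenbauer_ode:
  assumes "\<bar>1 - u\<bar> < 2"
  shows "of_real (1 - u^2) * gegenbauer n k 2 u - (2 * of_nat k + 3) * of_real u * gegenbauer n k 1 u
    + (n - of_nat k) * (n + of_nat k + 2) * gegenbauer n k 0 u = 0"
proof -
  let ?z = "of_real ((1 - u) / 2) :: complex"
  have "norm ?z < 1"
    using assms by (simp only: norm_of_real) simp
  define E where "E d = eval_fps ((fps_deriv ^^ d) (gegenbauer_fps n k)) ?z" for d
  define Z where "Z = ?z"
  have "Z * (1 - Z) * E 2
      + (of_nat k + 3/2 - (- n + of_nat k + (n + of_nat k + 2) + 1) * Z) * E 1
      - (- n + of_nat k) * (n + of_nat k + 2) * E 0 = 0"
    unfolding Z_def E_def gegenbauer_fps_def numeral_2_eq_2 One_nat_def funpow.simps o_apply id_apply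
    by (rule eval_fps_hypergeo_2_1_ode[OF half_integer_nonzero[of k] \<open>norm ?z < 1\<close>])
  then have "2 * Z * (1 - Z) * E 2 + (2 * of_nat k + 3) * (1 - 2 * Z) * E 1
      + 2 * ((n - of_nat k) * (n + of_nat k + 2)) * E 0 = 0"
    by (simp add: field_simps)
  moreover have "4 * gegenbauer n k 2 u = E 2" "2 * gegenbauer n k 1 u = - E 1"
    "gegenbauer n k 0 u = E 0"
    unfolding gegenbauer_def E_def by (simp_all add: power2_eq_square)
  moreover have "of_real (1 - u^2) = 4 * Z * (1 - Z)"
    by (simp add: Z_def field_simps power2_eq_square)
  moreover have "of_real u = 1 - 2 * Z" by (simp add: Z_def diff_divide_distrib)
  ultimately have "2 * (of_real (1 - u^2) * gegenbauer n k 2 u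
      - (2 * of_nat k + 3) * of_real u * gegenbauer n k 1 u
      + (n - of_nat k) * (n + of_nat k + 2) * gegenbauer n k 0 u) = 0"
    by algebra
  then show ?thesis unfolding mult_eq_0_iff by simp
qed

lemma gegenbauer_at_1: "gegenbauer n k 0 1 = 1"
  by (simp add: gegenbauer_def eval_fps_at_0 gegenbauer_fps_def del: fps_hypergeo_nth)

text \<open>
  At \<open>u = 1\<close> the equation loses its second-order term and determines the first derivative.
\<close>

lemma gegenbauer_deriv_at_1:
  "gegenbauer n k 1 1 = (n - of_nat k) * (n + of_nat k + 2) / (2 * of_nat k + 3)"
  using gegenbauer_ode[of 1 n k] half_integer_nonzero[of k 0]
  by (simp add: gegenbauer_at_1 field_simps)

section \<open>Two lemmas on real differential equations\<close>

lemma linear_ode_bound: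
  fixes q q1 q2 :: "'a :: real_inner"
  assumes "norm q2 \<le> M * (norm q + norm q1)" "0 \<le> M"
  shows "\<bar>2 * (q \<bullet> q1) + 2 * (q1 \<bullet> q2)\<bar> \<le> (1 + 3 * M) * (q \<bullet> q + q1 \<bullet> q1)"
proof -
  have sq: "2 * (norm q * norm q1) \<le> (norm q)\<^sup>2 + (norm q1)\<^sup>2"
    using sum_squares_bound[of "norm q" "norm q1"] by simp
  have "\<bar>q1 \<bullet> q2\<bar> \<le> norm q1 * norm q2" by (rule Cauchy_Schwarz_ineq2)
  also have "\<dots> \<le> norm q1 * (M * (norm q + norm q1))"
    using assms by (intro mult_left_mono) auto
  also have "\<dots> = M * (norm q * norm q1) + M * (norm q1)\<^sup>2"
    by (simp add: algebra_simps power2_eq_square)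
  finally have "2 * \<bar>q1 \<bullet> q2\<bar> \<le> M * (2 * (norm q * norm q1)) + 2 * (M * (norm q1)\<^sup>2)" by simp
  also have "\<dots> \<le> M * ((norm q)\<^sup>2 + (norm q1)\<^sup>2) + 2 * (M * (norm q1)\<^sup>2)"
    using sq assms(2) by (intro add_right_mono mult_left_mono)
  also have "\<dots> \<le> M * ((norm q)\<^sup>2 + (norm q1)\<^sup>2) + 2 * (M * ((norm q)\<^sup>2 + (norm q1)\<^sup>2))"
    using assms(2) by (intro add_left_mono mult_left_mono) auto
  finally have "2 * \<bar>q1 \<bullet> q2\<bar> \<le> 3 * M * ((norm q)\<^sup>2 + (norm q1)\<^sup>2)" by simp
  moreover have "2 * \<bar>q \<bullet> q1\<bar> \<le> (norm q)\<^sup>2 + (norm q1)\<^sup>2"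
    using Cauchy_Schwarz_ineq2[of q q1] sq by simp
  ultimately have "\<bar>2 * (q \<bullet> q1) + 2 * (q1 \<bullet> q2)\<bar> \<le> (1 + 3 * M) * ((norm q)\<^sup>2 + (norm q1)\<^sup>2)"
    by (simp add: algebra_simps)
  then show ?thesis by (simp add: power2_norm_eq_inner)
qed

text \<open>
  Uniqueness for the initial value problem. The energy \<open>\<bar>q\<bar>\<^sup>2 + \<bar>q'\<bar>\<^sup>2\<close> satisfies \<open>\<bar>e'\<bar> \<le> K e\<close> on a compact
  interval, so \<open>exp (K t) e\<close> increases and \<open>exp (- K t) e\<close> decreases; an energy that vanishes at \<open>t0\<close>
  therefore vanishes on both sides of \<open>t0\<close>.
\<close>

lemma second_order_linear_ode_zero:
  fixes q q1 q2 A B :: "real \<Rightarrow> complex"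
  assumes q: "\<And>t. t \<in> {a<..<b} \<Longrightarrow> (q has_vector_derivative q1 t) (at t)"
    and q1: "\<And>t. t \<in> {a<..<b} \<Longrightarrow> (q1 has_vector_derivative q2 t) (at t)"
    and ode: "\<And>t. t \<in> {a<..<b} \<Longrightarrow> q2 t = A t * q1 t + B t * q t"
    and A: "continuous_on {a<..<b} A" and B: "continuous_on {a<..<b} B"
    and t0: "t0 \<in> {a<..<b}" "q t0 = 0" "q1 t0 = 0" and t: "t \<in> {a<..<b}"
  shows "q t = 0"
proof -
  define S where "S = {min t t0..max t t0}"
  have S: "S \<subseteq> {a<..<b}" "compact S" "t \<in> S" "t0 \<in> S" using t0(1) t by (auto simp: S_def)
  have "bounded (A ` S)" "bounded (B ` S)"
    using A B S by (meson compact_continuous_image compact_imp_bounded continuous_on_subset)+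
  then obtain MA MB where M: "\<And>s. s \<in> S \<Longrightarrow> norm (A s) \<le> MA" "\<And>s. s \<in> S \<Longrightarrow> norm (B s) \<le> MB"
    by (metis bounded_iff imageI)
  define M where "M = max MA MB"
  have M0: "0 \<le> M" using M(1)[OF S(3)] norm_ge_zero order_trans unfolding M_def by (metis max.coboundedI1)
  have q2: "norm (q2 s) \<le> M * (norm (q s) + norm (q1 s))" if "s \<in> S" for s
  proof -
    have "norm (q2 s) \<le> norm (A s) * norm (q1 s) + norm (B s) * norm (q s)"
      using ode[of s] S that by (metis norm_mult norm_triangle_ineq subsetD)
    also have "\<dots> \<le> M * norm (q1 s) + M * norm (q s)"
      using M[OF that] by (intro add_mono mult_right_mono) (auto simp: M_def)
    finally show ?thesis by (simp add: algebra_simps)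
  qed
  define e where "e s = q s \<bullet> q s + q1 s \<bullet> q1 s" for s
  define e' where "e' s = 2 * (q s \<bullet> q1 s) + 2 * (q1 s \<bullet> q2 s)" for s
  define K where "K = 1 + 3 * M"
  have e: "(e has_real_derivative e' s) (at s)" if "s \<in> S" for s
  proof -
    have s: "s \<in> {a<..<b}" using that S by auto
    have "(e has_vector_derivative (q s \<bullet> q1 s + q1 s \<bullet> q s) + (q1 s \<bullet> q2 s + q2 s \<bullet> q1 s)) (at s)"
      unfolding e_def
      by (intro has_vector_derivative_add
          bounded_bilinear.has_vector_derivative[OF bounded_bilinear_inner] q[OF s] q1[OF s])
    then show ?thesis
      by (simp add: has_real_derivative_iff_has_vector_derivative e'_def inner_commute)
  qed
  have bound: "\<bar>e' s\<bar> \<le> K * e s" if "s \<in> S" for s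
    unfolding e'_def e_def K_def using linear_ode_bound[OF q2[OF that] M0] .
  have ex: "((\<lambda>s. exp (c * s) * e s) has_real_derivative exp (c * s) * (c * e s + e' s)) (at s)"
    if "s \<in> S" for s c
    using e[OF that] by (auto intro!: derivative_eq_intros simp: algebra_simps)
  have "e t \<le> 0"
  proof (cases "t \<le> t0")
    case True
    have "exp (K * t) * e t \<le> exp (K * t0) * e t0"
    proof (rule DERIV_nonneg_imp_nondecreasing[OF True])
      fix s assume "t \<le> s" "s \<le> t0"
      then have "s \<in> S" by (auto simp: S_def)
      from ex[OF this, of K] bound[OF this]
      show "\<exists>y. ((\<lambda>s. exp (K * s) * e s) has_real_derivative y) (at s) \<and> 0 \<le> y"
        by (intro exI[of _ "exp (K * s) * (K * e s + e' s)"]) auto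
    qed
    then show ?thesis using t0 by (simp add: e_def mult_le_0_iff)
  next
    case False
    have "exp (- K * t) * e t \<le> exp (- K * t0) * e t0"
    proof (rule DERIV_nonpos_imp_nonincreasing[where f = "\<lambda>s. exp (- K * s) * e s"])
      show "t0 \<le> t" using False by simp
      fix s assume "t0 \<le> s" "s \<le> t"
      then have "s \<in> S" by (auto simp: S_def)
      from ex[OF this, of "- K"] bound[OF this]
      show "\<exists>y. ((\<lambda>s. exp (- K * s) * e s) has_real_derivative y) (at s) \<and> y \<le> 0"
        by (intro exI[of _ "exp (- K * s) * (- K * e s + e' s)"]) (auto simp: mult_le_0_iff)
    qed
    then show ?thesis using t0 by (simp add: e_def mult_le_0_iff)
  qed
  moreover have "0 \<le> q t \<bullet> q t" "0 \<le> q1 t \<bullet> q1 t" by simp_all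
  ultimately have "q t \<bullet> q t = 0" unfolding e_def by linarith
  then show ?thesis by simp
qed

text \<open>
  A derivative of at least \<open>\<kappa> / (1 - u)\<close> makes \<open>f\<close> grow by at least \<open>\<kappa> / 2\<close> between \<open>u\<close> and the midpoint
  of \<open>u\<close> and \<open>1\<close>, for all \<open>u\<close> near \<open>1\<close>.
\<close>

lemma no_left_limit_if_derivative_large:
  fixes f f1 :: "real \<Rightarrow> real"
  assumes der: "\<And>u. u \<in> {0<..<1} \<Longrightarrow> (f has_real_derivative f1 u) (at u)"
    and large: "eventually (\<lambda>u. f1 u * (1 - u) \<ge> \<kappa>) (at_left 1)" and "\<kappa> > 0"
    and lim: "(f \<longlongrightarrow> L) (at_left 1)"
  shows False
proof -
  have "filterlim (\<lambda>u :: real. (1 + u) / 2) (at_left 1) (at_left 1)"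
    unfolding filterlim_at
    by (auto intro!: tendsto_eq_intros eventually_at_leftI[of 0])
  from filterlim_compose[OF lim this]
  have 0: "((\<lambda>u. f ((1 + u) / 2) - f u) \<longlongrightarrow> L - L) (at_left 1)"
    by (intro tendsto_diff lim)
  obtain b where b: "b < 1" "\<And>u. b < u \<Longrightarrow> u < 1 \<Longrightarrow> f1 u * (1 - u) \<ge> \<kappa>"
    using large unfolding eventually_at_left_field by auto
  have "f ((1 + u) / 2) - f u \<ge> \<kappa> / 2" if u: "max 0 b < u" "u < 1" for u
  proof -
    obtain \<xi> where \<xi>: "u < \<xi>" "\<xi> < (1 + u) / 2" "f ((1 + u) / 2) - f u = ((1 + u) / 2 - u) * f1 \<xi>"
      using MVT2[of u "(1 + u) / 2" f f1] u der by auto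
    have "\<kappa> \<le> f1 \<xi> * (1 - \<xi>)" using \<xi> u by (intro b) auto
    also have "\<dots> \<le> f1 \<xi> * (1 - u)"
    proof (rule mult_left_mono)
      have "0 < f1 \<xi> * (1 - \<xi>)" using \<open>\<kappa> \<le> f1 \<xi> * (1 - \<xi>)\<close> \<open>\<kappa> > 0\<close> by simp
      then show "0 \<le> f1 \<xi>" using \<xi> u by (simp add: zero_less_mult_iff)
    qed (use \<xi> in auto)
    also have "\<dots> = 2 * (((1 + u) / 2 - u) * f1 \<xi>)" by (simp add: field_simps)
    finally show ?thesis unfolding \<xi>(3) by simp
  qed
  then have "eventually (\<lambda>u. \<kappa> / 2 \<le> f ((1 + u) / 2) - f u) (at_left 1)"
    using b(1) by (intro eventually_at_leftI[of "max 0 b"]) auto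
  with 0 have "\<kappa> / 2 \<le> L - L"
    by (intro tendsto_lowerbound[OF 0]) auto
  then show False using \<open>\<kappa> > 0\<close> by simp
qed

section \<open>The scalar equations\<close>

definition weight :: "nat \<Rightarrow> real \<Rightarrow> complex" where
  "weight k u = of_real (sqrt (1 - u^2) ^ k)"

lemma one_minus_square_pos: "u \<in> {0<..<1} \<Longrightarrow> 0 < 1 - u^2" for u :: real
  by (simp add: power_less_one_iff abs_square_less_1)

lemma weight_nonzero: "u \<in> {0<..<1} \<Longrightarrow> weight k u \<noteq> 0"
  using one_minus_square_pos[of u] by (simp add: weight_def)

lemma weight_has_vector_derivative:
  assumes "u \<in> {0<..<1}"
  shows "(weight k has_vector_derivative
    - (of_nat k * of_real u / of_real (1 - u^2) * weight k u)) (at u)"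
proof -
  have pos: "0 < 1 - u^2" using assms by (rule one_minus_square_pos)
  have "((\<lambda>u. sqrt (1 - u^2) ^ k) has_real_derivative
      - (of_nat k * u / (1 - u^2) * sqrt (1 - u^2) ^ k)) (at u)"
  proof (cases k)
    case (Suc i)
    have s: "1 - u^2 = sqrt (1 - u^2) * sqrt (1 - u^2)" using pos by simp
    have "((\<lambda>u. sqrt (1 - u^2)) has_real_derivative - (u / sqrt (1 - u^2))) (at u)"
      using pos by (auto intro!: derivative_eq_intros simp: field_simps)
    from DERIV_power_Suc[OF this, of i]
    have "((\<lambda>u. sqrt (1 - u^2) ^ k) has_real_derivative
        (1 + of_nat i) * (- (u / sqrt (1 - u^2)) * sqrt (1 - u^2) ^ i)) (at u)"
      by (simp only: Suc)
    moreover have "(1 + of_nat i) * (- (u / sqrt (1 - u^2)) * sqrt (1 - u^2) ^ i)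
        = - (of_nat k * u / (sqrt (1 - u^2) * sqrt (1 - u^2)) * sqrt (1 - u^2) ^ k)"
    proof -
      have "(1 + of_nat i) * (- (u / r) * r ^ i) = - (of_nat k * u / (r * r) * r ^ k)" if "r \<noteq> 0" for r :: real
        using that by (simp add: Suc)
      then show ?thesis using pos by simp
    qed
    ultimately show ?thesis using s by metis
  qed simp
  then have "((\<lambda>u. of_real (sqrt (1 - u^2) ^ k) :: complex) has_vector_derivative
      of_real (- (of_nat k * u / (1 - u^2) * sqrt (1 - u^2) ^ k))) (at u)"
    by (rule has_vector_derivative_of_real)
  then show ?thesis
    by (simp add: weight_def[abs_def])
qed

lemma weight_Suc: "weight (Suc k) u = weight 1 u * weight k u"
  by (simp add: weight_def)

lemma weight_add: "weight (k + m) u = weight k u * weight m u"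
  by (simp add: weight_def power_add)

lemma weight_2: "u \<in> {0<..<1} \<Longrightarrow> weight 2 u = of_real (1 - u^2)"
  using one_minus_square_pos[of u] by (simp add: weight_def)

lemma weight_tendsto_0: "k > 0 \<Longrightarrow> (weight k \<longlongrightarrow> 0) (at_left 1)"
proof -
  assume k: "k > 0"
  have "((\<lambda>u :: real. sqrt (1 - u^2) ^ k) \<longlongrightarrow> sqrt (1 - 1^2) ^ k) (at_left 1)"
    by (intro tendsto_intros)
  then have "((\<lambda>u :: real. of_real (sqrt (1 - u^2) ^ k) :: complex) \<longlongrightarrow> of_real (sqrt (1 - 1^2) ^ k)) (at_left 1)"
    by (rule tendsto_of_real)
  then show ?thesis using k by (simp add: weight_def[abs_def] zero_power)
qed

text \<open>
  The solution \<open>(1 - u\<^sup>2)\<^bsup>k/2\<^esup> F(u)\<close> of the \<open>k\<close>-th scalar equation and its first two derivatives;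
  \<open>radial2\<close> is what the equation says the second derivative must be.
\<close>

definition radial :: "complex \<Rightarrow> nat \<Rightarrow> real \<Rightarrow> complex" where
  "radial n k u = weight k u * gegenbauer n k 0 u"

definition radial1 :: "complex \<Rightarrow> nat \<Rightarrow> real \<Rightarrow> complex" where
  "radial1 n k u = weight k u *
     (gegenbauer n k 1 u - of_nat k * of_real u / of_real (1 - u^2) * gegenbauer n k 0 u)"

definition radial2 :: "complex \<Rightarrow> nat \<Rightarrow> real \<Rightarrow> complex" where
  "radial2 n k u = (3 * of_real u * radial1 n k u
      + (of_nat k * (of_nat k + 1) / of_real (1 - u^2) - n * (n + 2)) * radial n k u) / of_real (1 - u^2)"

lemma radial_has_vector_derivative:
  assumes "u \<in> {0<..<1}"
  shows "(radial n k has_vector_derivative radial1 n k u) (at u)"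
proof -
  have "\<bar>1 - u\<bar> < 2" using assms by auto
  from has_vector_derivative_mult[OF weight_has_vector_derivative[OF assms]
      gegenbauer_has_vector_derivative[OF this, of n k 0], of k]
  show ?thesis
    by (simp add: radial_def[abs_def] radial1_def algebra_simps)
qed

lemma radial1_has_vector_derivative:
  assumes u: "u \<in> {0<..<1}"
  shows "(radial1 n k has_vector_derivative radial2 n k u) (at u)"
proof -
  have u2: "\<bar>1 - u\<bar> < 2" using assms by auto
  have pos: "0 < 1 - u^2" using assms by (rule one_minus_square_pos)
  define s :: complex where "s = of_real (1 - u^2)"
  define U :: complex where "U = of_real u"
  have s0: "s \<noteq> 0" using pos by (simp add: s_def del: of_real_diff)
  have sU: "s = 1 - U^2" by (simp add: s_def U_def)
  define w where "w = weight k u"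
  define g where "g d = gegenbauer n k d u" for d
  have "((\<lambda>u. u / (1 - u^2)) has_real_derivative ((1 + u^2) / (1 - u^2)^2)) (at u)"
    using pos by (auto intro!: derivative_eq_intros simp: power2_eq_square field_simps)
  then have "((\<lambda>u. of_real (u / (1 - u^2)) :: complex) has_vector_derivative
      of_real ((1 + u^2) / (1 - u^2)^2)) (at u)"
    by (rule has_vector_derivative_of_real)
  then have frac: "((\<lambda>u. of_nat k * (of_real u / of_real (1 - u^2)) :: complex) has_vector_derivative
      of_nat k * ((1 + U^2) / s^2)) (at u)"
    by (intro has_vector_derivative_mult_right) (simp add: U_def s_def)
  have "(radial1 n k has_vector_derivative
     w * (g 2 - (of_nat k * (U / s) * g 1 + of_nat k * ((1 + U^2) / s^2) * g 0))
     + - (of_nat k * U / s * w) * (g 1 - of_nat k * (U / s) * g 0)) (at u)"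
    using has_vector_derivative_mult[OF weight_has_vector_derivative[OF u, of k]
      has_vector_derivative_diff[OF gegenbauer_has_vector_derivative[OF u2, of n k 1]
        has_vector_derivative_mult[OF frac gegenbauer_has_vector_derivative[OF u2, of n k 0]]]]
    unfolding radial1_def[abs_def]
    by (simp add: g_def w_def U_def s_def numeral_2_eq_2 del: of_real_diff)
  moreover have "w * (g 2 - (of_nat k * (U / s) * g 1 + of_nat k * ((1 + U^2) / s^2) * g 0))
     + - (of_nat k * U / s * w) * (g 1 - of_nat k * (U / s) * g 0)
     = (3 * U * (w * (g 1 - of_nat k * U / s * g 0))
        + (of_nat k * (of_nat k + 1) / s - n * (n + 2)) * (w * g 0)) / s" (is "?L = ?R")
  proof -
    have ode: "s * g 2 - (2 * of_nat k + 3) * U * g 1 + (n - of_nat k) * (n + of_nat k + 2) * g 0 = 0"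
      using gegenbauer_ode[OF u2, of n k] by (simp add: g_def s_def U_def)
    have "s^2 * ?L = w * (s^2 * g 2 - of_nat k * U * s * g 1 - of_nat k * (1 + U^2) * g 0
        - of_nat k * U * (s * g 1 - of_nat k * U * g 0))"
      using s0 by (simp add: field_simps power2_eq_square)
    also have "\<dots> = 3 * U * (w * (s * g 1 - of_nat k * U * g 0))
        + (of_nat k * (of_nat k + 1) - n * (n + 2) * s) * (w * g 0)"
      using ode sU by algebra
    also have "\<dots> = s^2 * ?R"
      using s0 by (simp add: field_simps power2_eq_square)
    finally have eq: "s^2 * ?L = s^2 * ?R" .
    have "s^2 \<noteq> 0" using s0 by simp
    from iffD1[OF mult_left_cancel[OF this] eq] show ?thesis .
  qed
  ultimately show ?thesis
    by (simp add: radial2_def radial1_def radial_def g_def w_def U_def s_def)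
qed

lemma gegenbauer_tendsto: "(gegenbauer n k d \<longlongrightarrow> gegenbauer n k d 1) (at_left 1)"
proof -
  have "continuous (at 1) (gegenbauer n k d)"
    by (rule has_vector_derivative_continuous[OF gegenbauer_has_vector_derivative]) simp
  then have "(gegenbauer n k d \<longlongrightarrow> gegenbauer n k d 1) (at 1)" by (simp add: continuous_at)
  then show ?thesis by (rule tendsto_within_subset) simp
qed

lemma eventually_at_left_1_Ioo: "eventually (\<lambda>u :: real. u \<in> {0<..<1}) (at_left 1)"
  by (rule eventually_at_leftI[of 0]) auto

lemma radial_near_1_nonzero: "eventually (\<lambda>u. radial n k u \<noteq> 0) (at_left 1)"
proof -
  have "eventually (\<lambda>u. gegenbauer n k 0 u \<noteq> 0) (at_left 1)"
    using tendsto_imp_eventually_ne[OF gegenbauer_tendsto[of n k 0]] by (simp add: gegenbauer_at_1)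
  with eventually_at_left_1_Ioo show ?thesis
    by eventually_elim (use weight_nonzero in \<open>simp add: radial_def\<close>)
qed

text \<open>
  The equation that \<open>D\<close> becomes on a single coordinate in the basis of the columns of \<open>U\<close>. The
  existence of the limit \<open>L\<close> at \<open>1\<close> is what excludes the second solution.
\<close>

locale radial_solution =
  fixes n :: complex and k :: nat and h h1 h2 :: "real \<Rightarrow> complex" and L :: complex
  assumes h: "u \<in> {0<..<1} \<Longrightarrow> (h has_vector_derivative h1 u) (at u)"
    and h1: "u \<in> {0<..<1} \<Longrightarrow> (h1 has_vector_derivative h2 u) (at u)"
    and ode: "u \<in> {0<..<1} \<Longrightarrow> of_real (1 - u^2) * h2 u - 3 * of_real u * h1 u
       - of_nat k * (of_nat k + 1) / of_real (1 - u^2) * h u = - n * (n + 2) * h u"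
    and lim: "(h \<longlongrightarrow> L) (at_left 1)"
begin

text \<open>
  The factor \<open>(1 - u\<^sup>2)\<^bsup>3/2\<^esup>\<close> cancels the first-order term of the equation, so that the weighted
  Wronskian is constant.
\<close>

definition "wronskian u = weight 3 u * (h u * radial1 n k u - h1 u * radial n k u)"

lemma wronskian_constant: "\<exists>c. \<forall>u\<in>{0<..<1}. wronskian u = c"
proof -
  have der: "(wronskian has_vector_derivative 0) (at u within {0<..<1})" if u: "u \<in> {0<..<1}" for u
  proof -
    have s0: "(of_real (1 - u^2) :: complex) \<noteq> 0"
      using one_minus_square_pos[OF u] by (simp del: of_real_diff)
    have "(wronskian has_vector_derivative
       weight 3 u * ((h u * radial2 n k u + h1 u * radial1 n k u) - (h1 u * radial1 n k u + h2 u * radial n k u))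
       + - (of_nat 3 * of_real u / of_real (1 - u^2) * weight 3 u)
           * (h u * radial1 n k u - h1 u * radial n k u)) (at u)"
      unfolding wronskian_def
      by (intro has_vector_derivative_mult has_vector_derivative_diff weight_has_vector_derivative
          radial_has_vector_derivative radial1_has_vector_derivative h h1 u)
    moreover have "weight 3 u * ((h u * radial2 n k u + h1 u * radial1 n k u) - (h1 u * radial1 n k u + h2 u * radial n k u))
       + - (of_nat 3 * of_real u / of_real (1 - u^2) * weight 3 u)
           * (h u * radial1 n k u - h1 u * radial n k u) = 0" (is "?D = 0")
    proof -
      define s :: complex where "s = of_real (1 - u^2)"
      have s0: "s \<noteq> 0" using s0 by (simp add: s_def)
      define q where "q = of_nat k * (of_nat k + 1) / s"
      have r2: "s * radial2 n k u = 3 * of_real u * radial1 n k u + (q - n * (n + 2)) * radial n k u"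
        unfolding radial2_def s_def[symmetric] q_def[symmetric] using s0
        by (rule nonzero_mult_div_cancel_left[THEN trans[OF times_divide_eq_right]])
      have e2: "s * h2 u = 3 * of_real u * h1 u + (q - n * (n + 2)) * h u"
        using ode[OF u] unfolding s_def[symmetric] q_def[symmetric] by (simp add: algebra_simps)
      have "s * ?D = weight 3 u * (h u * (s * radial2 n k u) - (s * h2 u) * radial n k u
          - 3 * of_real u * (h u * radial1 n k u - h1 u * radial n k u))"
        unfolding s_def[symmetric] using s0 by (simp add: field_simps)
      also have "\<dots> = 0" unfolding r2 e2 by (simp add: algebra_simps)
      finally show ?thesis using s0 by (simp only: mult_eq_0_iff) simp
    qed
    ultimately show ?thesis
      by (simp add: has_vector_derivative_at_within)
  qed
  obtain c where "\<And>u. u \<in> {0<..<1} \<Longrightarrow> wronskian u = c"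
    by (rule has_vector_derivative_zero_constant[OF _ der]) auto
  then show ?thesis by blast
qed

text \<open>
  In the Wronskian \<open>c\<close>, the terms containing \<open>h\<close> rather than \<open>h'\<close> tend to \<open>0\<close>, because \<open>h\<close> has a limit and
  each of them keeps a positive power of \<open>1 - u\<^sup>2\<close>.
\<close>

lemma derivative_asymptotics:
  assumes c: "\<And>u. u \<in> {0<..<1} \<Longrightarrow> wronskian u = c"
  shows "((\<lambda>u. weight (k + 3) u * h1 u) \<longlongrightarrow> - c) (at_left 1)"
proof -
  have 1: "((\<lambda>u. h u * (weight (k + 3) u * gegenbauer n k 1 u
       - of_nat k * of_real u * weight (k + 1) u * gegenbauer n k 0 u)) \<longlongrightarrow>
       L * (0 * gegenbauer n k 1 1 - of_nat k * of_real 1 * 0 * gegenbauer n k 0 1)) (at_left 1)"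
    by (intro tendsto_mult tendsto_diff lim weight_tendsto_0 gegenbauer_tendsto tendsto_const
        tendsto_of_real tendsto_ident_at) simp_all
  have "((\<lambda>u. (h u * (weight (k + 3) u * gegenbauer n k 1 u
       - of_nat k * of_real u * weight (k + 1) u * gegenbauer n k 0 u) - c) / gegenbauer n k 0 u)
     \<longlongrightarrow> (0 - c) / 1) (at_left 1)"
    using 1 gegenbauer_tendsto[of n k 0]
    by (intro tendsto_divide tendsto_diff tendsto_const) (simp_all add: gegenbauer_at_1)
  moreover have "eventually (\<lambda>u. (h u * (weight (k + 3) u * gegenbauer n k 1 u
       - of_nat k * of_real u * weight (k + 1) u * gegenbauer n k 0 u) - c) / gegenbauer n k 0 u
     = weight (k + 3) u * h1 u) (at_left 1)"
    using radial_near_1_nonzero[of n k] eventually_at_left_1_Ioo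
  proof eventually_elim
    case (elim u)
    define s :: complex where "s = of_real (1 - u^2)"
    have s0: "s \<noteq> 0"
      using one_minus_square_pos[OF elim(2)] by (simp add: s_def del: of_real_diff)
    have g0: "gegenbauer n k 0 u \<noteq> 0" using elim(1) by (simp add: radial_def)
    have w: "weight (k + 3) u = weight 3 u * weight k u" "weight 3 u = s * weight 1 u"
      "weight (k + 1) u = weight 1 u * weight k u"
      using weight_add[of k 3 u] weight_add[of 2 1 u] weight_add[of k 1 u] weight_2[OF elim(2)]
      by (simp_all add: s_def)
    have "c = weight 3 u * (h u * radial1 n k u - h1 u * radial n k u)"
      using c[OF elim(2)] by (simp add: wronskian_def)
    also have "\<dots> = h u * (weight (k + 3) u * gegenbauer n k 1 u
       - of_nat k * of_real u * weight (k + 1) u * gegenbauer n k 0 u)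
        - weight (k + 3) u * h1 u * gegenbauer n k 0 u"
      using s0 unfolding radial_def radial1_def s_def[symmetric] w by (simp add: field_simps)
    finally show ?case using g0 by (simp add: field_simps)
  qed
  ultimately show ?thesis by (simp add: tendsto_cong)
qed

text \<open>
  If the constant were \<open>c \<noteq> 0\<close>, then \<open>h'\<close> would grow like \<open>- c (1 - u\<^sup>2)\<^bsup>-(k + 3)/2\<^esup>\<close>, hence at least
  like \<open>1 / (1 - u)\<close>. Multiplying by \<open>- cnj c\<close> turns the direction of growth into the positive real
  axis, where \<open>no_left_limit_if_derivative_large\<close> applies.
\<close>

lemma wronskian_zero:
  assumes "u \<in> {0<..<1}"
  shows "wronskian u = 0"
proof -
  obtain c where c: "\<And>u. u \<in> {0<..<1} \<Longrightarrow> wronskian u = c" using wronskian_constant by blast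
  have "c = 0"
  proof (rule ccontr)
    assume "c \<noteq> 0"
    define m where "m = (norm c)\<^sup>2 / 2"
    have m: "m > 0" using \<open>c \<noteq> 0\<close> by (simp add: m_def)
    define f where "f u = Re (- cnj c * h u)" for u
    define f1 where "f1 u = Re (- cnj c * h1 u)" for u
    have der: "(f has_real_derivative f1 u) (at u)" if "u \<in> {0<..<1}" for u
      unfolding f_def f1_def has_real_derivative_iff_has_vector_derivative
      by (intro bounded_linear.has_vector_derivative[OF bounded_linear_Re]
          has_vector_derivative_mult_right h that)
    have limf: "(f \<longlongrightarrow> Re (- cnj c * L)) (at_left 1)"
      unfolding f_def by (intro tendsto_intros lim)
    have "((\<lambda>u. Re (- cnj c * (weight (k + 3) u * h1 u))) \<longlongrightarrow> Re (- cnj c * - c)) (at_left 1)"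
      by (intro tendsto_Re tendsto_mult_left derivative_asymptotics c)
    moreover have "m < Re (- cnj c * - c)"
    proof -
      have "Re (- cnj c * - c) = (norm c)\<^sup>2"
        unfolding cmod_power2 by (simp add: power2_eq_square)
      then show ?thesis using m unfolding m_def by linarith
    qed
    ultimately have "eventually (\<lambda>u. m < Re (- cnj c * (weight (k + 3) u * h1 u))) (at_left 1)"
      by (rule order_tendstoD(1))
    with eventually_at_left_1_Ioo have "eventually (\<lambda>u. m / 2 \<le> f1 u * (1 - u)) (at_left 1)"
    proof eventually_elim
      case (elim u)
      define r where "r = sqrt (1 - u^2)"
      have r: "0 < r" "r \<le> 1" "r\<^sup>2 = 1 - u\<^sup>2"
        using one_minus_square_pos[OF elim(1)] by (simp_all add: r_def)
      have "weight (k + 3) u = of_real (r ^ (k + 3))" by (simp add: weight_def r_def)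
      then have "- cnj c * (weight (k + 3) u * h1 u) = of_real (r ^ (k + 3)) * (- cnj c * h1 u)"
        by (simp only: ac_simps)
      then have "Re (- cnj c * (weight (k + 3) u * h1 u)) = r ^ (k + 3) * f1 u"
        by (simp only: f1_def Re_complex_of_real Im_complex_of_real times_complex.simps mult_zero_left diff_zero)
      then have 1: "m < r ^ (k + 3) * f1 u" using elim by simp
      then have f1: "0 < f1 u" using m r by (smt (verit) zero_less_power zero_less_mult_pos)
      have "r ^ (k + 3) \<le> r ^ 2" using r by (intro power_decreasing) auto
      also have "\<dots> \<le> 2 * (1 - u)"
      proof -
        have "2 * (1 - u) - (1 - u\<^sup>2) = (1 - u)\<^sup>2" by (simp add: power2_eq_square algebra_simps)
        then show ?thesis unfolding r(3) using zero_le_power2[of "1 - u"] by linarith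
      qed
      finally have "r ^ (k + 3) * f1 u \<le> 2 * (1 - u) * f1 u"
        using f1 by (intro mult_right_mono) auto
      then show ?case using 1 by (simp add: algebra_simps)
    qed
    from no_left_limit_if_derivative_large[OF der this _ limf] m show False by simp
  qed
  then show ?thesis using c assms by simp
qed

text \<open>
  A vanishing Wronskian at one point where \<open>radial\<close> does not vanish makes \<open>h\<close> and a multiple of
  \<open>radial\<close> agree to first order at that point. Such points exist near \<open>1\<close>; elsewhere
  \<open>radial\<close> can have zeros, which is why the Wronskian alone does not finish the proof.
\<close>

theorem solution_unique: "\<exists>a. \<forall>u\<in>{0<..<1}. h u = a * radial n k u"
proof -
  have "eventually (\<lambda>u. radial n k u \<noteq> 0 \<and> u \<in> {0<..<1}) (at_left (1::real))"
    using radial_near_1_nonzero[of n k] eventually_at_left_1_Ioo by eventually_elim simp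
  then obtain t0 where t0: "t0 \<in> {0<..<1}" "radial n k t0 \<noteq> 0"
    using eventually_happens'[OF trivial_limit_at_left_real] by blast
  define a where "a = h t0 / radial n k t0"
  define q where "q u = h u - a * radial n k u" for u
  define q1 where "q1 u = h1 u - a * radial1 n k u" for u
  define q2 where "q2 u = h2 u - a * radial2 n k u" for u
  define A :: "real \<Rightarrow> complex" where "A u = 3 * of_real u / of_real (1 - u^2)" for u
  define B :: "real \<Rightarrow> complex" where
    "B u = (of_nat k * (of_nat k + 1) / of_real (1 - u^2) - n * (n + 2)) / of_real (1 - u^2)" for u
  have s0: "(of_real (1 - u^2) :: complex) \<noteq> 0" if "u \<in> {0<..<1}" for u
    using one_minus_square_pos[OF that] by (simp del: of_real_diff)
  have "q u = 0" if "u \<in> {0<..<1}" for u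
  proof (rule second_order_linear_ode_zero[where q = q and ?q1.0 = q1 and ?q2.0 = q2 and A = A and B = B])
    show "(q has_vector_derivative q1 t) (at t)" if "t \<in> {0<..<1}" for t
      unfolding q_def q1_def
      by (intro has_vector_derivative_diff has_vector_derivative_mult_right radial_has_vector_derivative h that)
    show "(q1 has_vector_derivative q2 t) (at t)" if "t \<in> {0<..<1}" for t
      unfolding q2_def q1_def
      by (intro has_vector_derivative_diff has_vector_derivative_mult_right radial1_has_vector_derivative h1 that)
    show "q2 t = A t * q1 t + B t * q t" if t: "t \<in> {0<..<1}" for t
    proof -
      define s :: complex where "s = of_real (1 - t^2)"
      have s: "s \<noteq> 0" using s0[OF t] by (simp add: s_def)
      have e2: "h2 t = A t * h1 t + B t * h t"
      proof -
        have "h2 t = (3 * of_real t * h1 t + of_nat k * (of_nat k + 1) / s * h t - n * (n + 2) * h t) / s"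
          using ode[OF t] s unfolding s_def[symmetric] by (simp add: nonzero_eq_divide_eq algebra_simps)
        then show ?thesis unfolding A_def B_def s_def[symmetric]
          by (simp add: add_divide_distrib diff_divide_distrib left_diff_distrib)
      qed
      have "radial2 n k t = A t * radial1 n k t + B t * radial n k t"
        by (simp add: radial2_def A_def B_def add_divide_distrib)
      then show ?thesis unfolding q_def q1_def q2_def e2 by (simp add: algebra_simps)
    qed
    show "continuous_on {0<..<1} A" "continuous_on {0<..<1} B"
      unfolding A_def B_def using s0 by (auto intro!: continuous_intros simp del: of_real_diff)
    show "t0 \<in> {0<..<1}" by fact
    show "q t0 = 0" using t0 by (simp add: q_def a_def)
    have "h t0 * radial1 n k t0 = h1 t0 * radial n k t0"
      using wronskian_zero[OF t0(1)] weight_nonzero[OF t0(1)] by (simp add: wronskian_def)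
    then show "q1 t0 = 0" using t0 by (simp add: q1_def a_def field_simps)
    show "u \<in> {0<..<1}" by fact
  qed
  then show ?thesis by (auto simp: q_def)
qed

end

section \<open>Both equations in the basis of the columns of \<open>U\<close>\<close>

text \<open>
  The action on coordinates of an operator that maps column \<open>k\<close> to \<open>f k\<close> times the next column plus
  \<open>g k\<close> times the previous one.
\<close>

definition ladder :: "nat \<Rightarrow> (nat \<Rightarrow> complex) \<Rightarrow> (nat \<Rightarrow> complex) \<Rightarrow> cvec \<Rightarrow> cvec" where
  "ladder l f g x k = (if k = 0 then 0 else f (k - 1) * x (k - 1)) +
     (if k = l then 0 else g (k + 1) * x (k + 1))"

lemma sum_ladder:
  assumes "f l = 0" "g 0 = 0"
  shows "(\<Sum>k\<le>l. (f k * V (k + 1) + g k * V (k - 1)) * x k) = (\<Sum>k\<le>l. V k * ladder l f g x k)"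
proof -
  have up: "(\<Sum>k\<le>l. f k * V (k + 1) * x k) = (\<Sum>k\<le>l. V k * (if k = 0 then 0 else f (k - 1) * x (k - 1)))"
  proof -
    have "(\<Sum>k\<le>l. f k * V (k + 1) * x k) = (\<Sum>k<l. f k * V (k + 1) * x k)"
      using assms by (simp add: lessThan_Suc_atMost[symmetric])
    then show ?thesis
      by (subst (2) sum.atMost_shift) (simp add: mult.left_commute mult.assoc)
  qed
  have down: "(\<Sum>k\<le>l. g k * V (k - 1) * x k) = (\<Sum>k\<le>l. V k * (if k = l then 0 else g (k + 1) * x (k + 1)))"
  proof -
    have "(\<Sum>k\<le>l. V k * (if k = l then 0 else g (k + 1) * x (k + 1)))
        = (\<Sum>k<l. V k * (g (k + 1) * x (k + 1)))"
      by (simp add: lessThan_Suc_atMost[symmetric])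
    then show ?thesis
      using assms by (subst sum.atMost_shift) (simp add: mult.left_commute mult.assoc)
  qed
  show ?thesis
    using up down by (simp add: ladder_def distrib_left distrib_right sum.distrib)
qed

lemma mat_vec_column_combination:
  assumes "\<And>j. j \<le> l \<Longrightarrow> x j = mat_vec l (U_mat l) y j"
  shows "mat_vec l M x j = (\<Sum>k\<le>l. mat_vec l M (\<lambda>i. U_mat l i k) j * y k)"
proof -
  have "mat_vec l M x j = mat_vec l M (\<lambda>i. \<Sum>k\<le>l. U_mat l i k * y k) j"
    using assms by (intro mat_vec_cong) (simp add: mat_vec_def)
  then show ?thesis by (simp add: mat_vec_sum)
qed

lemma mat_vec_scale: "c * mat_vec l M x j = mat_vec l M (\<lambda>k. c * x k) j"
  by (simp add: mat_vec_def sum_distrib_left mult.left_commute)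

lemma mat_vec_plus: "mat_vec l M x j + mat_vec l M y j = mat_vec l M (\<lambda>k. x k + y k) j"
  by (simp add: mat_vec_def sum.distrib distrib_left)

lemma mat_vec_minus: "mat_vec l M x j - mat_vec l M y j = mat_vec l M (\<lambda>k. x k - y k) j"
  by (simp add: mat_vec_def sum_subtractf right_diff_distrib)

lemma C_sum_expansion:
  assumes X: "\<And>j. j \<le> l \<Longrightarrow> X j = mat_vec l (U_mat l) x j" and j: "j \<le> l"
  shows "mat_vec l (C_sum l) X j = mat_vec l (U_mat l) (\<lambda>k. - (of_nat k * (of_nat k + 1)) * x k) j"
proof -
  have "mat_vec l (C_sum l) X j = (\<Sum>k\<le>l. mat_vec l (C_sum l) (\<lambda>i. U_mat l i k) j * x k)"
    using X by (rule mat_vec_column_combination)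
  also have "\<dots> = (\<Sum>k\<le>l. U_mat l j k * (- (of_nat k * (of_nat k + 1)) * x k))"
    using j by (intro sum.cong) (simp_all add: C_sum_column)
  finally show ?thesis by (simp add: mat_vec_def)
qed

lemma D_equation_decoupled:
  assumes D: "\<And>j. j \<le> l \<Longrightarrow> s * X2 j - 3 * t * X1 j + 1 / s * mat_vec l (C_sum l) X j = ev * X j"
    and X: "\<And>j. j \<le> l \<Longrightarrow> X j = mat_vec l (U_mat l) x j"
    and X1: "\<And>j. j \<le> l \<Longrightarrow> X1 j = mat_vec l (U_mat l) x1 j"
    and X2: "\<And>j. j \<le> l \<Longrightarrow> X2 j = mat_vec l (U_mat l) x2 j"
    and k: "k \<le> l"
  shows "s * x2 k - 3 * t * x1 k - of_nat k * (of_nat k + 1) / s * x k = ev * x k"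
proof -
  have C: "mat_vec l (C_sum l) X j = mat_vec l (U_mat l) (\<lambda>k. - (of_nat k * (of_nat k + 1)) * x k) j"
    if "j \<le> l" for j
    using X that by (rule C_sum_expansion)
  have "mat_vec l (U_mat l) (\<lambda>k. s * x2 k - 3 * t * x1 k
      + 1 / s * (- (of_nat k * (of_nat k + 1)) * x k) - ev * x k) j = 0" if j: "j \<le> l" for j
    using D[OF j] unfolding C[OF j] X[OF j] X1[OF j] X2[OF j] mat_vec_scale mat_vec_minus mat_vec_plus
    by (simp add: mat_vec_def right_diff_distrib sum_subtractf)
  from U_mat_injective[OF this k] show ?thesis by simp
qed

lemma E_equation_ladder:
  assumes E: "\<And>j. j \<le> l \<Longrightarrow> c1 * mat_vec l (A0 l) X1 j
      + c2 * mat_vec l (\<lambda>r s. C1 l r s - C0 l r s) X j + c3 * mat_vec l (C_sum l) X j = ev * X j"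
    and X: "\<And>j. j \<le> l \<Longrightarrow> X j = mat_vec l (U_mat l) x j"
    and X1: "\<And>j. j \<le> l \<Longrightarrow> X1 j = mat_vec l (U_mat l) x1 j"
    and k: "k \<le> l"
  shows "c1 * ladder l (up_coeff l) (down_coeff l) x1 k
      + c2 * ladder l (\<lambda>k. of_nat k * up_coeff l k) (\<lambda>k. - ((of_nat k + 1) * down_coeff l k)) x k
      - c3 * (of_nat k * (of_nat k + 1)) * x k = ev * x k"
proof -
  let ?L1 = "ladder l (up_coeff l) (down_coeff l) x1"
  let ?L2 = "ladder l (\<lambda>k. of_nat k * up_coeff l k) (\<lambda>k. - ((of_nat k + 1) * down_coeff l k)) x"
  have A: "mat_vec l (A0 l) X1 j = mat_vec l (U_mat l) ?L1 j" if j: "j \<le> l" for j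
  proof -
    have "mat_vec l (A0 l) X1 j = (\<Sum>k\<le>l. mat_vec l (A0 l) (\<lambda>i. U_mat l i k) j * x1 k)"
      using X1 by (rule mat_vec_column_combination)
    also have "\<dots> = (\<Sum>k\<le>l. (up_coeff l k * U_mat l j (k + 1) + down_coeff l k * U_mat l j (k - 1)) * x1 k)"
      unfolding mat_vec_A0[OF j] A0_column[OF j] ..
    also have "\<dots> = (\<Sum>k\<le>l. U_mat l j k * ?L1 k)"
      by (rule sum_ladder) simp_all
    finally show ?thesis by (simp add: mat_vec_def)
  qed
  have C: "mat_vec l (\<lambda>r s. C1 l r s - C0 l r s) X j = mat_vec l (U_mat l) ?L2 j" if j: "j \<le> l" for j
  proof -
    have "mat_vec l (\<lambda>r s. C1 l r s - C0 l r s) X j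
       = (\<Sum>k\<le>l. mat_vec l (\<lambda>r s. C1 l r s - C0 l r s) (\<lambda>i. U_mat l i k) j * x k)"
      using X by (rule mat_vec_column_combination)
    also have "\<dots> = (\<Sum>k\<le>l. (of_nat k * up_coeff l k * U_mat l j (k + 1)
        + - ((of_nat k + 1) * down_coeff l k) * U_mat l j (k - 1)) * x k)"
      using C_diff_column[OF j] by (intro sum.cong) simp_all
    also have "\<dots> = (\<Sum>k\<le>l. U_mat l j k * ?L2 k)"
      by (rule sum_ladder) simp_all
    finally show ?thesis by (simp add: mat_vec_def)
  qed
  have S: "mat_vec l (C_sum l) X j = mat_vec l (U_mat l) (\<lambda>k. - (of_nat k * (of_nat k + 1)) * x k) j"
    if "j \<le> l" for j
    using X that by (rule C_sum_expansion)
  have "mat_vec l (U_mat l) (\<lambda>k. c1 * ?L1 k + c2 * ?L2 k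
      + c3 * (- (of_nat k * (of_nat k + 1)) * x k) - ev * x k) j = 0" if j: "j \<le> l" for j
    using E[OF j] unfolding A[OF j] C[OF j] S[OF j] X[OF j] mat_vec_scale mat_vec_minus mat_vec_plus
    by (simp add: mat_vec_def right_diff_distrib sum_subtractf)
  from U_mat_injective[OF this k] show ?thesis by (simp add: mult.assoc)
qed

lemma weight_at_1: "weight k 1 = (if k = 0 then 1 else 0)"
  by (simp add: weight_def power_0_left)

lemma radial_tendsto: "(radial n k \<longlongrightarrow> radial n k 1) (at_left 1)"
proof -
  have "(weight k \<longlongrightarrow> weight k 1) (at_left 1)"
  proof (cases "k = 0")
    case True
    have "weight 0 = (\<lambda>_. 1)" by (simp add: weight_def[abs_def])
    with True show ?thesis by simp
  next
    case False
    then show ?thesis using weight_tendsto_0[of k] by (simp add: weight_at_1)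
  qed
  from tendsto_mult[OF this gegenbauer_tendsto[of n k 0]] show ?thesis
    by (simp add: radial_def[abs_def])
qed

lemma radial_at_1: "radial n k 1 = (if k = 0 then 1 else 0)"
  by (simp add: radial_def weight_at_1 gegenbauer_at_1)

text \<open>
  The combination of \<open>A\<^sub>0\<close> and \<open>C\<^sub>1 - C\<^sub>0\<close> in \<open>E\<close> differentiates only the hypergeometric factor when it
  raises the index; the terms in which the power of \<open>1 - u\<^sup>2\<close> is differentiated cancel. The power
  gains a factor and matches the new index.
\<close>

lemma raising_term:
  assumes "u \<in> {0<..<1}"
  shows "weight 1 u * radial1 n k u + of_nat k * (of_real u / weight 1 u) * radial n k u
    = weight (Suc k) u * gegenbauer n k 1 u"
proof -
  define w where "w = weight 1 u"
  have w: "w \<noteq> 0" using weight_nonzero[OF assms] by (simp add: w_def)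
  have s: "of_real (1 - u^2) = w * w"
    using weight_add[of 1 1 u] weight_2[OF assms] by (simp add: w_def numeral_2_eq_2)
  show ?thesis
    unfolding radial_def radial1_def s weight_Suc w_def[symmetric]
    using w by (simp add: field_simps)
qed

text \<open>
  When the index is lowered, the terms add up instead, but they still contain the power of
  \<open>1 - u\<^sup>2\<close> that belongs to the new index.
\<close>

lemma lowering_term:
  assumes "u \<in> {0<..<1}"
  shows "weight 1 u * radial1 n (Suc k) u - (of_nat k + 2) * (of_real u / weight 1 u) * radial n (Suc k) u
    = weight k u * (of_real (1 - u^2) * gegenbauer n (Suc k) 1 u
        - (2 * of_nat k + 3) * of_real u * gegenbauer n (Suc k) 0 u)"
proof -
  define w where "w = weight 1 u"
  have w: "w \<noteq> 0" using weight_nonzero[OF assms] by (simp add: w_def)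
  have s: "of_real (1 - u^2) = w * w"
    using weight_add[of 1 1 u] weight_2[OF assms] by (simp add: w_def numeral_2_eq_2)
  show ?thesis
    unfolding radial_def radial1_def s weight_Suc w_def[symmetric]
    using w by (simp add: field_simps)
qed

text \<open>
  Divide the \<open>k\<close>-th coordinate of the equation for \<open>E\<close> by \<open>(1 - u\<^sup>2)\<^bsup>k/2\<^esup>\<close> and let \<open>u\<close> tend to \<open>1\<close>. All terms
  have limits, which are known from \<open>gegenbauer_at_1\<close> and \<open>gegenbauer_deriv_at_1\<close>.
\<close>

lemma recursion_from_ladder:
  assumes k: "k \<le> l"
    and E: "\<And>u. u \<in> {0<..<1} \<Longrightarrow>
       \<i> / 2 * weight 1 u * ladder l (up_coeff l) (down_coeff l) (\<lambda>k. a k * radial1 n k u) k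
      + \<i> / 2 * (of_real u / weight 1 u)
          * ladder l (\<lambda>k. of_nat k * up_coeff l k) (\<lambda>k. - ((of_nat k + 1) * down_coeff l k))
              (\<lambda>k. a k * radial n k u) k
      - 1 / 2 * (of_nat k * (of_nat k + 1)) * (a k * radial n k u) = \<mu> * (a k * radial n k u)"
  shows "\<i> * (of_nat k * (of_nat l - of_nat k + 1) * (n - of_nat k + 1) * (n + of_nat k + 1)
             / (2 * (2 * of_nat k - 1) * (2 * of_nat k + 1))) * (if k = 0 then 0 else a (k - 1))
        - of_nat k * (of_nat k + 1) / 2 * a k
        - (if k = l then 0 else \<i> * ((of_nat k + 1) * (of_nat l + of_nat k + 2) / 2) * a (k + 1))
        = \<mu> * a k"
proof -
  \<comment> \<open>What raising and lowering contribute after the division, and the resulting equation \<open>R = 0\<close>.\<close>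
  define P where "P u = (if k = 0 then 0 else \<i> / 2 * up_coeff l (k - 1) * a (k - 1) * gegenbauer n (k - 1) 1 u)" for u
  define Q where "Q u = (if k = l then 0 else \<i> / 2 * down_coeff l (k + 1) * a (k + 1) *
     (of_real (1 - u^2) * gegenbauer n (Suc k) 1 u - (2 * of_nat k + 3) * of_real u * gegenbauer n (Suc k) 0 u))" for u
  define R where "R u = P u + Q u - (1 / 2 * (of_nat k * (of_nat k + 1)) + \<mu>) * a k * gegenbauer n k 0 u" for u
  have "R u = 0" if u: "u \<in> {0<..<1}" for u
  proof -
    define w where "w = weight 1 u"
    define v where "v = of_real u / weight 1 u"
    have 1: "\<i> / 2 * w * (if k = 0 then 0 else up_coeff l (k - 1) * (a (k - 1) * radial1 n (k - 1) u))
        + \<i> / 2 * v * (if k = 0 then 0 else of_nat (k - 1) * up_coeff l (k - 1) * (a (k - 1) * radial n (k - 1) u))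
        = weight k u * P u"
    proof (cases k)
      case (Suc i)
      have "\<i> / 2 * w * (up_coeff l i * (a i * radial1 n i u))
        + \<i> / 2 * v * (of_nat i * up_coeff l i * (a i * radial n i u))
        = \<i> / 2 * up_coeff l i * a i * (w * radial1 n i u + of_nat i * v * radial n i u)"
        by (simp add: algebra_simps)
      also have "\<dots> = \<i> / 2 * up_coeff l i * a i * (weight (Suc i) u * gegenbauer n i 1 u)"
        unfolding w_def v_def raising_term[OF u] ..
      finally show ?thesis by (simp add: Suc P_def)
    qed (simp add: P_def)
    have 2: "\<i> / 2 * w * (if k = l then 0 else down_coeff l (k + 1) * (a (k + 1) * radial1 n (k + 1) u))
        + \<i> / 2 * v * (if k = l then 0 else - ((of_nat (k + 1) + 1) * down_coeff l (k + 1)) * (a (k + 1) * radial n (k + 1) u))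
        = weight k u * Q u"
    proof (cases "k = l")
      case False
      have "\<i> / 2 * w * (down_coeff l (k + 1) * (a (k + 1) * radial1 n (k + 1) u))
        + \<i> / 2 * v * (- ((of_nat (k + 1) + 1) * down_coeff l (k + 1)) * (a (k + 1) * radial n (k + 1) u))
        = \<i> / 2 * down_coeff l (k + 1) * a (k + 1) * (w * radial1 n (Suc k) u - (of_nat k + 2) * v * radial n (Suc k) u)"
        by (simp add: algebra_simps)
      also have "\<dots> = \<i> / 2 * down_coeff l (k + 1) * a (k + 1) * (weight k u * (of_real (1 - u^2) * gegenbauer n (Suc k) 1 u
        - (2 * of_nat k + 3) * of_real u * gegenbauer n (Suc k) 0 u))"
        unfolding w_def v_def lowering_term[OF u] ..
      finally show ?thesis using False by (simp add: Q_def)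
    qed (simp add: Q_def)
    have "weight k u * P u + weight k u * Q u
       - 1 / 2 * (of_nat k * (of_nat k + 1)) * (a k * radial n k u) = \<mu> * (a k * radial n k u)"
      using E[OF u] unfolding 1[symmetric] 2[symmetric] ladder_def v_def[symmetric] unfolding w_def[symmetric]
      by (simp only: distrib_left[of "\<i> / 2 * w"] distrib_left[of "\<i> / 2 * v"] add_ac)
    then have "weight k u * R u = 0" by (simp add: R_def radial_def algebra_simps)
    then show ?thesis using weight_nonzero[OF u] by simp
  qed
  then have R0: "eventually (\<lambda>u. R u = 0) (at_left 1)"
    using eventually_at_left_1_Ioo by (rule eventually_mono[rotated])
  have "(P \<longlongrightarrow> P 1) (at_left 1)"
    unfolding P_def by (auto intro!: tendsto_intros gegenbauer_tendsto[of n _ 1, simplified])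
  moreover have "(Q \<longlongrightarrow> Q 1) (at_left 1)"
  proof (cases "k = l")
    case False
    have "((\<lambda>u. \<i> / 2 * down_coeff l (k + 1) * a (k + 1) *
        (of_real (1 - u^2) * gegenbauer n (Suc k) 1 u
         - (2 * of_nat k + 3) * of_real u * gegenbauer n (Suc k) 0 u)) \<longlongrightarrow>
        \<i> / 2 * down_coeff l (k + 1) * a (k + 1) *
        (of_real (1 - 1^2) * gegenbauer n (Suc k) 1 1
         - (2 * of_nat k + 3) * of_real 1 * gegenbauer n (Suc k) 0 1)) (at_left 1)"
      by (intro tendsto_intros gegenbauer_tendsto)
    with False show ?thesis unfolding Q_def by (simp only: if_False)
  qed (simp add: Q_def[abs_def])
  ultimately have "(R \<longlongrightarrow> R 1) (at_left 1)"
    unfolding R_def by (intro tendsto_intros gegenbauer_tendsto)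
  moreover have "(R \<longlongrightarrow> 0) (at_left 1)"
    using R0 by (simp add: tendsto_eventually)
  ultimately have R1: "R 1 = 0"
    by (intro tendsto_unique[OF trivial_limit_at_left_real])
  have "P 1 = \<i> * (of_nat k * (of_nat l - of_nat k + 1) * (n - of_nat k + 1) * (n + of_nat k + 1)
             / (2 * (2 * of_nat k - 1) * (2 * of_nat k + 1))) * (if k = 0 then 0 else a (k - 1))"
  proof (cases k)
    case (Suc i)
    have "gegenbauer n i 1 1 = (n - of_nat k + 1) * (n + of_nat k + 1) / (2 * of_nat k + 1)"
      unfolding gegenbauer_deriv_at_1 by (simp add: Suc algebra_simps)
    moreover have "up_coeff l i = of_nat k * (of_nat l - of_nat k + 1) / (2 * of_nat k - 1)"
      by (simp add: up_coeff_def Suc add.commute)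
    ultimately show ?thesis by (simp add: P_def Suc)
  qed (simp add: P_def)
  moreover have "Q 1 = - (if k = l then 0 else \<i> * ((of_nat k + 1) * (of_nat l + of_nat k + 2) / 2) * a (k + 1))"
  proof -
    have "(2 * of_nat k + 3 :: complex) \<noteq> 0"
      using half_integer_nonzero[of k 0] by (simp add: field_simps)
    moreover have "down_coeff l (k + 1) = (of_nat k + 1) * (of_nat l + of_nat k + 2) / (2 * of_nat k + 3)"
      unfolding down_coeff_def
      by (rule arg_cong2[where f = "(/)"]) (simp_all add: algebra_simps)
    ultimately have "down_coeff l (k + 1) * (2 * of_nat k + 3) = (of_nat k + 1) * (of_nat l + of_nat k + 2)"
      by simp
    moreover have "Q 1 = - (if k = l then 0
        else \<i> / 2 * (down_coeff l (k + 1) * (2 * of_nat k + 3)) * a (k + 1))"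
      by (simp add: Q_def gegenbauer_at_1 field_simps)
    ultimately show ?thesis by simp
  qed
  ultimately show ?thesis
    using R1 unfolding R_def gegenbauer_at_1 by (simp add: algebra_simps)
qed

section \<open>Associated functions at the identity\<close>

lemma mat_exp_0: "mat_exp (0 :: real^'m^'m) = mat 1"
proof -
  have pow: "((**) (0 :: real^'m^'m) ^^ k) (mat 1) = (if k = 0 then mat 1 else 0)" for k
    by (cases k) auto
  have "(\<Sum>k. (1 / fact k) *\<^sub>R (((**) (0 :: real^'m^'m) ^^ k) (mat 1)))
      = (\<Sum>k\<in>{0}. (1 / fact k) *\<^sub>R (((**) (0 :: real^'m^'m) ^^ k) (mat 1)))"
    by (rule suminf_finite) (auto simp: pow)
  then show ?thesis by (simp add: mat_exp_def pow)
qed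

lemma a_curve_0: "a_curve 0 = mat 1"
  by (simp add: a_curve_def mat_exp_0)

lemma Lambda_basis_entries:
  "(Lambda_basis $ p) $ 1 $ 4 = (if p = 1 then 1 else 0)"
  "(Lambda_basis $ p) $ 2 $ 4 = (if p = 2 then 1 else 0)"
  "(Lambda_basis $ p) $ 3 $ 4 = (if p = 3 then 1 else 0)"
  using exhaust_3[of p] by (auto simp: Lambda_basis_def wedge_def e4_def axis_def)

text \<open>
  The first three entries of the last columns of the basis matrices form the identity matrix. This is the
  uniqueness that the definite description in \<open>a_map\<close> relies on.
\<close>

lemma Lambda_basis_expansion_unique:
  assumes "(\<Sum>p\<in>UNIV. c p *\<^sub>R Lambda_basis $ p) = Lambda_basis $ q"
  shows "c p = (if p = q then 1 else 0)"
proof -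
  have "(\<Sum>p\<in>UNIV. c p *\<^sub>R Lambda_basis $ p) $ i $ 4 = (\<Sum>p\<in>UNIV. c p * ((Lambda_basis $ p) $ i $ 4))" for i
    by (simp add: sum_component)
  then have "(\<Sum>p\<in>UNIV. c p * ((Lambda_basis $ p) $ i $ 4)) = (Lambda_basis $ q) $ i $ 4" for i
    using assms by simp
  from this[of 1] this[of 2] this[of 3] show ?thesis
    using exhaust_3[of p] by (auto simp: Lambda_basis_entries sum_3)
qed

lemma a_map_1: "a_map (mat 1) = mat 1"
  unfolding a_map_def
proof (rule the_equality)
  show "\<forall>q. mat 1 ** Lambda_basis $ q ** transpose (mat 1)
      = (\<Sum>p\<in>UNIV. (mat 1 $ p $ q) *\<^sub>R Lambda_basis $ p)"
  proof
    fix q :: 3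
    have "(\<Sum>p\<in>UNIV. (mat 1 $ p $ q) *\<^sub>R Lambda_basis $ p)
        = (\<Sum>p\<in>UNIV. if p = q then Lambda_basis $ p else 0)"
      by (rule sum.cong) (auto simp: mat_def)
    then show "mat 1 ** Lambda_basis $ q ** transpose (mat 1)
      = (\<Sum>p\<in>UNIV. (mat 1 $ p $ q) *\<^sub>R Lambda_basis $ p)"
      by simp
  qed
  fix A :: "real^3^3"
  assume A: "\<forall>q. mat 1 ** Lambda_basis $ q ** transpose (mat 1) = (\<Sum>p\<in>UNIV. (A $ p $ q) *\<^sub>R Lambda_basis $ p)"
  have "(\<Sum>p\<in>UNIV. (A $ p $ q) *\<^sub>R Lambda_basis $ p) = Lambda_basis $ q" for q
    using A[rule_format, of q] unfolding matrix_mul_lid matrix_mul_rid transpose_mat by (rule sym)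
  then have "A $ p $ q = (if p = q then 1 else 0)" for p q
    by (rule Lambda_basis_expansion_unique)
  then show "A = mat 1"
    by (simp add: vec_eq_iff mat_def)
qed

lemma associated_function_at_1:
  fixes \<pi> :: "real^3^3 \<Rightarrow> complex^'n^'n" and \<Phi> :: "real^4^4 \<Rightarrow> complex^'n^'n"
  assumes "irreducible_rep_SO3 l \<pi>" "irreducible_spherical_function l \<pi> \<Phi>"
    "associated_function l \<pi> \<Phi> H" "j \<le> l"
  shows "H 1 j = 1"
proof -
  obtain v where v: "weight_basis l \<pi> v"
    and H: "\<And>\<theta>. \<theta> \<in> {0..<pi/2} \<Longrightarrow> H_group \<pi> \<Phi> (a_curve \<theta>) *v v j = H (cos \<theta>) j *s v j"
    using assms(3,4) unfolding associated_function_def by blast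
  have "H_group \<pi> \<Phi> (mat 1) = mat 1"
  proof -
    have "\<pi> (mat 1) = mat 1" "\<Phi> (mat 1) = mat 1"
      using assms unfolding irreducible_rep_SO3_def irreducible_spherical_function_def by auto
    moreover have "matrix_inv (mat 1 :: complex^'n^'n) = mat 1"
    proof -
      have "\<exists>B :: complex^'n^'n. mat 1 ** B = mat 1 \<and> B ** mat 1 = mat 1"
        by (intro exI[of _ "mat 1"]) simp
      from someI_ex[OF this] show ?thesis unfolding matrix_inv_def by simp
    qed
    ultimately show ?thesis by (simp add: H_group_def a_map_1)
  qed
  then have "H 1 j *s v j = v j"
    using H[of 0] by (simp add: a_curve_0)
  then have "(H 1 j - 1) *s v j = 0"
    by (simp only: vec.scale_left_diff_distrib vec.scale_one right_minus_eq)
  moreover have "v j \<noteq> 0"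
    using v assms(4) vec.dependent_zero[of "v ` {0..l}"] unfolding weight_basis_def by force
  ultimately show ?thesis by (simp only: vec.scale_eq_0_iff right_minus_eq) simp
qed

section \<open>The simultaneous eigenfunctions\<close>

lemma continuous_on_Ioc_at_leftD:
  fixes f :: "real \<Rightarrow> 'a :: topological_space"
  assumes "continuous_on {a<..b} f" "a < b"
  shows "(f \<longlongrightarrow> f b) (at_left b)"
  by (rule continuous_on_Icc_at_leftD[of "(a + b) / 2"])
    (use assms in \<open>auto elim: continuous_on_subset\<close>)

lemma mat_vec_has_vector_derivative:
  assumes "\<And>j. j \<le> l \<Longrightarrow> ((\<lambda>t. X t j) has_vector_derivative X1 u j) (at u)"
  shows "((\<lambda>t. mat_vec l M (X t) k) has_vector_derivative mat_vec l M (X1 u) k) (at u)"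
  unfolding mat_vec_def using assms
  by (intro has_vector_derivative_sum has_vector_derivative_mult_right) auto

text \<open>
  The coordinates \<open>U\<^sup>-\<^sup>1 H\<close> inherit differentiability and the limit at \<open>1\<close> from \<open>H\<close>, so each of them is a
  solution to which \<open>solution_unique\<close> applies.
\<close>

lemma eigenfunction_expansion:
  assumes D: "eigenfunction_on l (op_D l) (- n * (n + 2)) H {0<..<1}"
    and cont: "\<forall>j\<le>l. continuous_on {0<..1} (\<lambda>u. H u j)"
  obtains a where
    "\<And>u k. u \<in> {0<..<1} \<Longrightarrow> k \<le> l \<Longrightarrow> mat_vec l (U_inv l) (H u) k = a k * radial n k u"
    "\<And>u k. u \<in> {0<..<1} \<Longrightarrow> k \<le> l \<Longrightarrow>
       mat_vec l (U_inv l) (vec_deriv H u) k = a k * radial1 n k u"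
proof -
  define h where "h k u = mat_vec l (U_inv l) (H u) k" for k u
  define h1 where "h1 k u = mat_vec l (U_inv l) (vec_deriv H u) k" for k u
  define h2 where "h2 k u = mat_vec l (U_inv l) (vec_deriv (vec_deriv H) u) k" for k u
  have h: "(h k has_vector_derivative h1 k u) (at u)" if u: "u \<in> {0<..<1}" for k u
  proof -
    have "((\<lambda>t. H t j) has_vector_derivative vec_deriv H u j) (at u)" if "j \<le> l" for j
      using D u that unfolding eigenfunction_on_def twice_differentiable_on_def vec_deriv_def
      by (auto simp: vector_derivative_works)
    then show ?thesis unfolding h_def h1_def by (rule mat_vec_has_vector_derivative)
  qed
  have h1: "(h1 k has_vector_derivative h2 k u) (at u)" if u: "u \<in> {0<..<1}" for k u
  proof -
    have "(\<lambda>t. vec_deriv H t j) differentiable (at u)" if "j \<le> l" for j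
      using D u that unfolding eigenfunction_on_def twice_differentiable_on_def by blast
    then have "((\<lambda>t. vec_deriv H t j) has_vector_derivative vec_deriv (vec_deriv H) u j) (at u)"
      if "j \<le> l" for j
      unfolding vec_deriv_def[of "vec_deriv H"] using that by (simp add: vector_derivative_works[symmetric])
    then show ?thesis unfolding h1_def h2_def by (rule mat_vec_has_vector_derivative)
  qed
  have lim: "(h k \<longlongrightarrow> h k 1) (at_left 1)" for k
  proof -
    have "((\<lambda>u. H u j) \<longlongrightarrow> H 1 j) (at_left 1)" if "j \<le> l" for j
      using cont that by (intro continuous_on_Ioc_at_leftD[of 0]) auto
    then show ?thesis unfolding h_def mat_vec_def by (intro tendsto_intros) auto
  qed
  have ode: "of_real (1 - u^2) * h2 k u - 3 * of_real u * h1 k u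
       - of_nat k * (of_nat k + 1) / of_real (1 - u^2) * h k u = - n * (n + 2) * h k u"
    if u: "u \<in> {0<..<1}" and k: "k \<le> l" for u k
    unfolding h_def h1_def h2_def
  proof (rule D_equation_decoupled[OF _ _ _ _ k, where X = "H u" and ?X1.0 = "vec_deriv H u"
        and ?X2.0 = "vec_deriv (vec_deriv H) u"])
    fix j assume j: "j \<le> l"
    have "op_D l H u j = - n * (n + 2) * H u j"
      using D u j unfolding eigenfunction_on_def by blast
    then show "of_real (1 - u^2) * vec_deriv (vec_deriv H) u j - 3 * of_real u * vec_deriv H u j
        + 1 / of_real (1 - u^2) * mat_vec l (C_sum l) (H u) j = - n * (n + 2) * H u j"
      unfolding op_D_def C_sum_def by (simp only: of_real_divide of_real_1)
  qed (simp_all add: U_inv_right)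
  have "\<exists>c. \<forall>u\<in>{0<..<1}. h k u = c * radial n k u" if "k \<le> l" for k
  proof -
    interpret radial_solution n k "h k" "h1 k" "h2 k" "h k 1"
      by unfold_locales (use h h1 ode lim that in auto)
    show ?thesis by (rule solution_unique)
  qed
  then obtain a where a: "\<And>k u. k \<le> l \<Longrightarrow> u \<in> {0<..<1} \<Longrightarrow> h k u = a k * radial n k u"
    by metis
  have "h1 k u = a k * radial1 n k u" if u: "u \<in> {0<..<1}" and k: "k \<le> l" for u k
  proof (rule vector_derivative_unique_at)
    show "((\<lambda>t. a k * radial n k t) has_vector_derivative h1 k u) (at u)"
      using h[OF u] by (rule has_vector_derivative_transform_within_open[of _ _ _ "{0<..<1}"])
        (use u k a in auto)
    show "((\<lambda>t. a k * radial n k t) has_vector_derivative a k * radial1 n k u) (at u)"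
      by (intro has_vector_derivative_mult_right radial_has_vector_derivative u)
  qed
  with a show ?thesis using that unfolding h_def h1_def by blast
qed

theorem corollary5p7:
  fixes l :: nat and H :: "real \<Rightarrow> nat \<Rightarrow> complex" and n \<mu> :: complex
  assumes "even l"
    and "eigenfunction_on l (op_D l) (- n * (n + 2)) H {0<..<1}"
    and "eigenfunction_on l (op_E l) \<mu> H {0<..<1}"
    and "\<forall>j\<le>l. continuous_on {0<..1} (\<lambda>u. H u j)"
  shows "\<exists>a :: nat \<Rightarrow> complex.
     (\<forall>u\<in>{0<..1}. \<forall>j\<le>l.
        H u j = mat_vec l (U_mat l) (mat_vec l (T_mat l u)
          (\<lambda>k. a k * hypergeometric [- n + of_nat k, n + of_nat k + 2] [of_nat k + 3/2]
                       (of_real ((1 - u) / 2)))) j) \<and>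
     (\<forall>j<l.
        \<i> * (of_nat j * (of_nat l - of_nat j + 1) * (n - of_nat j + 1) * (n + of_nat j + 1)
             / (2 * (2 * of_nat j - 1) * (2 * of_nat j + 1))) * (if j = 0 then 0 else a (j - 1))
        - of_nat j * (of_nat j + 1) / 2 * a j
        - \<i> * ((of_nat j + 1) * (of_nat l + of_nat j + 2) / 2) * a (j + 1)
        = \<mu> * a j) \<and>
     (\<i> * (of_nat l * (n - of_nat l + 1) * (n + of_nat l + 1)
           / (2 * (2 * of_nat l - 1) * (2 * of_nat l + 1))) * (if l = 0 then 0 else a (l - 1))
      - of_nat l * (of_nat l + 1) / 2 * a l
      = \<mu> * a l) \<and>
     (\<forall>j\<le>l. H 1 j = a 0) \<and>
     (\<forall>(\<pi> :: real^3^3 \<Rightarrow> complex^'n^'n) (\<Phi> :: real^4^4 \<Rightarrow> complex^'n^'n).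
        irreducible_rep_SO3 l \<pi> \<and> irreducible_spherical_function l \<pi> \<Phi> \<and>
        associated_function l \<pi> \<Phi> H \<longrightarrow> a 0 = 1)"
proof -
  obtain a where
    a: "\<And>u k. u \<in> {0<..<1} \<Longrightarrow> k \<le> l \<Longrightarrow> mat_vec l (U_inv l) (H u) k = a k * radial n k u"
    and a1: "\<And>u k. u \<in> {0<..<1} \<Longrightarrow> k \<le> l \<Longrightarrow>
       mat_vec l (U_inv l) (vec_deriv H u) k = a k * radial1 n k u"
    using eigenfunction_expansion[OF assms(2,4)] by blast
  have X: "H u j = mat_vec l (U_mat l) (\<lambda>k. a k * radial n k u) j" if "u \<in> {0<..<1}" "j \<le> l" for u j
  proof -
    have "H u j = mat_vec l (U_mat l) (mat_vec l (U_inv l) (H u)) j"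
      by (simp add: U_inv_right that)
    also have "\<dots> = mat_vec l (U_mat l) (\<lambda>k. a k * radial n k u) j"
      using a that by (intro mat_vec_cong) auto
    finally show ?thesis .
  qed
  have X1: "vec_deriv H u j = mat_vec l (U_mat l) (\<lambda>k. a k * radial1 n k u) j"
    if "u \<in> {0<..<1}" "j \<le> l" for u j
  proof -
    have "vec_deriv H u j = mat_vec l (U_mat l) (mat_vec l (U_inv l) (vec_deriv H u)) j"
      by (simp add: U_inv_right that)
    also have "\<dots> = mat_vec l (U_mat l) (\<lambda>k. a k * radial1 n k u) j"
      using a1 that by (intro mat_vec_cong) auto
    finally show ?thesis .
  qed
  \<comment> \<open>At \<open>u = 1\<close> only continuity is known, so the expansion is obtained as a limit.\<close>
  have at_1: "H 1 j = mat_vec l (U_mat l) (\<lambda>k. a k * radial n k 1) j" if j: "j \<le> l" for j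
  proof (rule tendsto_unique[OF trivial_limit_at_left_real])
    show "((\<lambda>u. H u j) \<longlongrightarrow> H 1 j) (at_left 1)"
      using assms(4) j by (intro continuous_on_Ioc_at_leftD[of 0]) auto
    have "((\<lambda>u. mat_vec l (U_mat l) (\<lambda>k. a k * radial n k u) j) \<longlongrightarrow>
        mat_vec l (U_mat l) (\<lambda>k. a k * radial n k 1) j) (at_left 1)"
      unfolding mat_vec_def by (intro tendsto_intros radial_tendsto)
    moreover have "eventually (\<lambda>u. mat_vec l (U_mat l) (\<lambda>k. a k * radial n k u) j = H u j) (at_left 1)"
      using eventually_at_left_1_Ioo by eventually_elim (simp add: X j)
    ultimately show "((\<lambda>u. H u j) \<longlongrightarrow> mat_vec l (U_mat l) (\<lambda>k. a k * radial n k 1) j) (at_left 1)"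
      by (rule Lim_transform_eventually)
  qed
  have form: "H u j = mat_vec l (U_mat l) (mat_vec l (T_mat l u)
          (\<lambda>k. a k * hypergeometric [- n + of_nat k, n + of_nat k + 2] [of_nat k + 3/2]
                       (of_real ((1 - u) / 2)))) j" if u: "u \<in> {0<..1}" and j: "j \<le> l" for u j
  proof -
    have "H u j = mat_vec l (U_mat l) (\<lambda>k. a k * radial n k u) j"
      using X[of u j] at_1[of j] u j by (cases "u = 1") auto
    also have "\<dots> = mat_vec l (U_mat l) (mat_vec l (T_mat l u)
          (\<lambda>k. a k * hypergeometric [- n + of_nat k, n + of_nat k + 2] [of_nat k + 3/2]
                       (of_real ((1 - u) / 2)))) j"
    proof (rule mat_vec_cong)
      fix k assume "k \<le> l"
      then show "a k * radial n k u = mat_vec l (T_mat l u)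
          (\<lambda>k. a k * hypergeometric [- n + of_nat k, n + of_nat k + 2] [of_nat k + 3/2]
                       (of_real ((1 - u) / 2))) k"
        unfolding mat_vec_T_mat[OF \<open>k \<le> l\<close>] radial_def weight_def gegenbauer_def gegenbauer_fps_def
          hypergeometric_def
        by (simp only: power_0 funpow_0 mult_1 mult.left_commute)
    qed
    finally show ?thesis .
  qed
  \<comment> \<open>All \<open>radial n k\<close> with \<open>k > 0\<close> vanish at \<open>1\<close>.\<close>
  have H1: "H 1 j = a 0" if "j \<le> l" for j
  proof -
    have "H 1 j = (\<Sum>k\<le>l. if k = 0 then U_mat l j k * a k else 0)"
      unfolding at_1[OF that] mat_vec_def by (intro sum.cong) (simp_all add: radial_at_1)
    then show ?thesis by (simp add: U_mat_first_column[OF that])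
  qed
  \<comment> \<open>Both recursions of the theorem at once: for \<open>k = l\<close> the last term drops out.\<close>
  have rec: "\<i> * (of_nat k * (of_nat l - of_nat k + 1) * (n - of_nat k + 1) * (n + of_nat k + 1)
             / (2 * (2 * of_nat k - 1) * (2 * of_nat k + 1))) * (if k = 0 then 0 else a (k - 1))
        - of_nat k * (of_nat k + 1) / 2 * a k
        - (if k = l then 0 else \<i> * ((of_nat k + 1) * (of_nat l + of_nat k + 2) / 2) * a (k + 1))
        = \<mu> * a k" if k: "k \<le> l" for k
  proof (rule recursion_from_ladder[OF k])
    fix u :: real assume u: "u \<in> {0<..<1}"
    show "\<i> / 2 * weight 1 u * ladder l (up_coeff l) (down_coeff l) (\<lambda>k. a k * radial1 n k u) k
      + \<i> / 2 * (of_real u / weight 1 u)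
          * ladder l (\<lambda>k. of_nat k * up_coeff l k) (\<lambda>k. - ((of_nat k + 1) * down_coeff l k))
              (\<lambda>k. a k * radial n k u) k
      - 1 / 2 * (of_nat k * (of_nat k + 1)) * (a k * radial n k u) = \<mu> * (a k * radial n k u)"
    proof (rule E_equation_ladder[OF _ X[OF u] X1[OF u] k])
      fix j assume "j \<le> l"
      then have "op_E l H u j = \<mu> * H u j"
        using assms(3) u unfolding eigenfunction_on_def by blast
      then show "\<i> / 2 * weight 1 u * mat_vec l (A0 l) (vec_deriv H u) j
        + \<i> / 2 * (of_real u / weight 1 u) * mat_vec l (\<lambda>r s. C1 l r s - C0 l r s) (H u) j
        + 1 / 2 * mat_vec l (C_sum l) (H u) j = \<mu> * H u j"
        unfolding op_E_def C_sum_def weight_def by (simp only: power_one_right of_real_divide)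
    qed
  qed
  show ?thesis
  proof (intro exI[of _ a] conjI allI impI ballI)
    show "a 0 = 1" if "irreducible_rep_SO3 l \<pi> \<and> irreducible_spherical_function l \<pi> \<Phi> \<and>
        associated_function l \<pi> \<Phi> H"
      for \<pi> :: "real^3^3 \<Rightarrow> complex^'n^'n" and \<Phi> :: "real^4^4 \<Rightarrow> complex^'n^'n"
      using associated_function_at_1[of l \<pi> \<Phi> H 0] that H1[of 0] by simp
  next
    fix j assume "j < l"
    then show "\<i> * (of_nat j * (of_nat l - of_nat j + 1) * (n - of_nat j + 1) * (n + of_nat j + 1)
             / (2 * (2 * of_nat j - 1) * (2 * of_nat j + 1))) * (if j = 0 then 0 else a (j - 1))
        - of_nat j * (of_nat j + 1) / 2 * a j
        - \<i> * ((of_nat j + 1) * (of_nat l + of_nat j + 2) / 2) * a (j + 1)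
        = \<mu> * a j"
      using rec[of j] by simp
  next
    show "\<i> * (of_nat l * (n - of_nat l + 1) * (n + of_nat l + 1)
           / (2 * (2 * of_nat l - 1) * (2 * of_nat l + 1))) * (if l = 0 then 0 else a (l - 1))
      - of_nat l * (of_nat l + 1) / 2 * a l
      = \<mu> * a l"
      using rec[of l] by simp
  qed (use form H1 in blast)+
qed

end
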